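(* The semigroup $(\mathbf P_t)_{t\ge0}$ has the Feller property: for every $t\ge0$ and every bounded continuous function $F:\Gamma_X\to\mathbb R$ (continuity with respect to the vague topology), the function $\gamma\mapsto(\mathbf P_tF)(\gamma)=\int_{\Gamma_X}F(\eta)\,\mathbf P_t(\gamma,d\eta)$ is again bounded and continuous on $\Gamma_X$.
   Context: $X$ is a locally compact second countable Hausdorff space, $m$ a non-atomic Radon measure on $X$. $\Gamma_X$ is the space of locally finite subsets of $X$, identified with $\sum_{x\in\gamma}\varepsilon_x$ and equipped with the vague topology (weakest topology making $\gamma\mapsto\sum_{x\in\gamma}\varphi(x)$ continuous for all continuous compactly supported $\varphi$). $\pi_{zm}$ is the Poisson measure on $\Gamma_X$ with intensity $zm$. For $t>0$, $\mathbf P_t(\gamma,\cdot)$ is the law of $\eta_1+\eta_2$, where $\eta_1=\sum_{x\in\gamma}a(x)\varepsilon_x$ with $(a(x))_{x\in\gamma}$ i.i.d. $\{0,1\}$-valued, $P(a(x)=1)=e^{-t}$, and $\eta_2\sim\pi_{(1-e^{-t})m}$ independent of $\eta_1$; $\mathbf P_0(\gamma,\cdot)=\varepsilon_\gamma$. *)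

theory Defs
  imports "HOL-Probability.Probability"
begin

definition borel_of :: "'a topology \<Rightarrow> 'a measure" where
  "borel_of T = sigma (topspace T) {U. openin T U}"

text \<open>Radon measure on (a locally compact second countable Hausdorff space) X:
  a Borel measure that is finite on compact sets.\<close>
definition radon_measure :: "'a topology \<Rightarrow> 'a measure \<Rightarrow> bool" where
  "radon_measure X m \<longleftrightarrow> sets m = sets (borel_of X) \<and>
     (\<forall>K. compactin X K \<longrightarrow> emeasure m K < \<infinity>)"

definition non_atomic :: "'a topology \<Rightarrow> 'a measure \<Rightarrow> bool" where
  "non_atomic X m \<longleftrightarrow> (\<forall>x\<in>topspace X. emeasure m {x} = 0)"

definition Cc :: "'a topology \<Rightarrow> ('a \<Rightarrow> real) set" where
  "Cc X = {\<phi>. continuous_map X euclideanreal \<phi> \<and>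
      (\<exists>K. compactin X K \<and> (\<forall>x\<in>topspace X - K. \<phi> x = 0))}"

definition Conf :: "'a topology \<Rightarrow> 'a set set" where
  "Conf X = {\<gamma>. \<gamma> \<subseteq> topspace X \<and> (\<forall>K. compactin X K \<longrightarrow> finite (\<gamma> \<inter> K))}"

text \<open>The pairing of a configuration with a function: sum over points of gamma
  (only finitely many non-zero terms for compactly supported phi).\<close>
definition conf_sum :: "('a \<Rightarrow> real) \<Rightarrow> 'a set \<Rightarrow> real" where
  "conf_sum \<phi> \<gamma> = (\<Sum>x\<in>{x\<in>\<gamma>. \<phi> x \<noteq> 0}. \<phi> x)"

definition vague :: "'a topology \<Rightarrow> 'a set topology" where
  "vague X = topology_generated_by
     ({Conf X} \<union> {{\<gamma>\<in>Conf X. conf_sum \<phi> \<gamma> \<in> U} | \<phi> U. \<phi> \<in> Cc X \<and> open U})"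

definition is_poisson :: "'a topology \<Rightarrow> 'a measure \<Rightarrow> real \<Rightarrow> 'a set measure \<Rightarrow> bool" where
  "is_poisson X m z \<mu> \<longleftrightarrow> prob_space \<mu> \<and> sets \<mu> = sets (borel_of (vague X)) \<and>
     (\<forall>(n::nat) (B::nat \<Rightarrow> 'a set) (k::nat \<Rightarrow> nat).
        (\<forall>i<n. B i \<in> sets m \<and> compactin X (X closure_of B i)) \<longrightarrow>
        (\<forall>i<n. \<forall>j<n. i \<noteq> j \<longrightarrow> B i \<inter> B j = {}) \<longrightarrow>
        measure \<mu> {\<gamma>\<in>Conf X. \<forall>i<n. card (\<gamma> \<inter> B i) = k i} =
          (\<Prod>i<n. (z * measure m (B i)) ^ k i / fact (k i) * exp (- (z * measure m (B i)))))"

definition poisson_measure :: "'a topology \<Rightarrow> 'a measure \<Rightarrow> real \<Rightarrow> 'a set measure" where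
  "poisson_measure X m z = (THE \<mu>. is_poisson X m z \<mu>)"

text \<open>The kernel P_t(gamma, .): law of the independent thinning of gamma (retention
  probability exp(-t)) superposed with an independent Poisson configuration of
  intensity (1 - exp(-t)) m.\<close>
definition PP :: "'a topology \<Rightarrow> 'a measure \<Rightarrow> real \<Rightarrow> 'a set \<Rightarrow> 'a set measure" where
  "PP X m t \<gamma> = (if t = 0 then return (borel_of (vague X)) \<gamma>
     else distr
       ((Pi\<^sub>M \<gamma> (\<lambda>_. measure_pmf (bernoulli_pmf (exp (- t)))))
          \<Otimes>\<^sub>M poisson_measure X m (1 - exp (- t)))
       (borel_of (vague X))
       (\<lambda>(a, \<eta>). {x\<in>\<gamma>. a x} \<union> \<eta>))"

end

theory Submission
  imports Defs
begin

text \<open>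
  The heart of the matter is a coupling. Around each of the finitely many points of \<open>\<gamma>\<close> in a large
  compact set \<open>K\<close> place a small neighbourhood; a configuration close to \<open>\<gamma>\<close> has exactly one point in
  each of them and no other point in \<open>K\<close>. So if \<open>\<gamma>\<^sub>k\<close> lies in the \<open>k\<close>-th such neighbourhood of \<open>\<gamma>\<close>, its
  points can be matched injectively with labels in such a way that, when the retention variables are
  read off from one common Bernoulli field through the labels, the thinned configurations converge
  for \<^emph>\<open>every\<close> realisation. A Poisson configuration almost surely avoids the countably many points
  involved, because the intensity has no atoms, so it can be superposed without disturbing
  convergence, and dominated convergence concludes. The same matching, without thinning, shows
  that these neighbourhoods form a neighbourhood base, so that the Borel sets of the vague topology
  are generated by the counting maps. Since \<open>poisson_measure\<close> is a definite description, existence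
  and uniqueness of the Poisson measure have to be proved as well.
\<close>

section \<open>Configurations and the vague topology\<close>

text \<open>Continuity is tested along sequences although no metric for the vague topology is
  constructed: if continuity failed at \<open>\<gamma>\<close>, each of the countably many
  neighbourhoods attached to \<open>\<gamma>\<close> would contain a bad configuration, and the
  coupling contradicts any such choice. Indexing the Bernoulli field by all labels at once puts
  every thinning on the same probability space, and injectivity of the labels is what gives each
  thinning its correct law. Configurations are sets, so superposition is a union; a point shared
  with the Poisson part would be counted once instead of twice, which is why shared points must be
  excluded almost surely. Existence of the Poisson measure goes through generating functions: they
  multiply over independent pieces, turn a Poisson number of independent points into an exponential
  without multinomial counting, and give back the joint law of the counts through their
  coefficients.\<close>

lemma topspace_vague [simp]: "topspace (vague X) = Conf X"
  unfolding vague_def topology_generated_by_topspace by blast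

lemma openin_vague_conf_sum:
  assumes "\<phi> \<in> Cc X" "open U"
  shows "openin (vague X) {\<gamma> \<in> Conf X. conf_sum \<phi> \<gamma> \<in> U}"
  unfolding vague_def by (rule topology_generated_by_Basis) (use assms in blast)

text \<open>A subbasis suffices: eventual membership passes to finite intersections, and to a union
  through the member that contains \<open>l\<close>.\<close>

lemma limitin_vague:
  assumes l: "l \<in> Conf X" and f: "\<And>n. f n \<in> Conf X"
    and lim: "\<And>\<phi>. \<phi> \<in> Cc X \<Longrightarrow> ((\<lambda>n. conf_sum \<phi> (f n)) \<longlongrightarrow> conf_sum \<phi> l) F"
  shows "limitin (vague X) f l F"
  unfolding limitin_def
proof (intro conjI allI impI)
  fix U assume U: "openin (vague X) U \<and> l \<in> U"
  then have "generate_topology_on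
     ({Conf X} \<union> {{\<gamma>\<in>Conf X. conf_sum \<phi> \<gamma> \<in> U} | \<phi> U. \<phi> \<in> Cc X \<and> open U}) U"
    unfolding vague_def using openin_topology_generated_by by blast
  then have "l \<in> U \<longrightarrow> eventually (\<lambda>n. f n \<in> U) F"
  proof (induction rule: generate_topology_on.induct)
    case (Int a b)
    then show ?case by (auto simp: eventually_conj_iff)
  next
    case (UN K)
    show ?case
    proof
      assume "l \<in> \<Union>K"
      then obtain k where k: "k \<in> K" "l \<in> k" by blast
      then have "eventually (\<lambda>n. f n \<in> k) F" using UN by blast
      then show "eventually (\<lambda>n. f n \<in> \<Union>K) F"
        by (rule eventually_mono) (use k in blast)
    qed
  next
    case (Basis s)
    then consider "s = Conf X" | \<phi> V where "\<phi> \<in> Cc X" "open V" "s = {\<gamma>\<in>Conf X. conf_sum \<phi> \<gamma> \<in> V}"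
      by auto
    then show ?case
    proof cases
      case 2
      then show ?thesis using lim[of \<phi>] f by (auto dest: topological_tendstoD)
    qed (simp add: f)
  qed simp
  then show "eventually (\<lambda>n. f n \<in> U) F" using U by simp
qed (simp add: l)

section \<open>Borel sigma-algebra of a topology\<close>

lemma space_borel_of [simp]: "space (borel_of T) = topspace T"
  unfolding borel_of_def by (rule space_measure_of) (auto dest: openin_subset)

lemma sets_borel_of: "sets (borel_of T) = sigma_sets (topspace T) {U. openin T U}"
  unfolding borel_of_def by (rule sets_measure_of) (auto dest: openin_subset)

lemma openin_in_borel_of: "openin T U \<Longrightarrow> U \<in> sets (borel_of T)"
  by (auto simp: sets_borel_of)

lemma closedin_in_borel_of: "closedin T U \<Longrightarrow> U \<in> sets (borel_of T)"
  using sets.Diff[OF sets.top[of "borel_of T"] openin_in_borel_of[of T "topspace T - U"]]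
  by (auto simp: closedin_def Diff_Diff_Int Int_absorb1)

lemma continuous_map_imp_borel_measurable:
  assumes "continuous_map T euclideanreal F"
  shows "F \<in> borel_measurable (borel_of T)"
proof (rule borel_measurableI)
  fix S :: "real set" assume "open S"
  then have "openin T {x \<in> topspace T. F x \<in> S}"
    using assms by (auto simp: continuous_map_def)
  then show "F -` S \<inter> space (borel_of T) \<in> sets (borel_of T)"
    by (auto simp: vimage_def Int_def conj_commute intro!: openin_in_borel_of)
qed

section \<open>Finite sums over configurations\<close>

lemma conf_sum_eq:
  assumes "\<And>x. x \<in> A \<Longrightarrow> x \<notin> K \<Longrightarrow> \<phi> x = 0" "finite (A \<inter> K)"
  shows "conf_sum \<phi> A = (\<Sum>x\<in>A \<inter> K. \<phi> x)"
  unfolding conf_sum_def using assms by (intro sum.mono_neutral_left) auto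

lemma Conf_subset: "\<gamma> \<in> Conf X \<Longrightarrow> A \<subseteq> \<gamma> \<Longrightarrow> A \<in> Conf X"
  unfolding Conf_def by (auto intro: finite_subset[of "A \<inter> _" "\<gamma> \<inter> _"])

lemma Conf_Un: "\<gamma> \<in> Conf X \<Longrightarrow> \<eta> \<in> Conf X \<Longrightarrow> \<gamma> \<union> \<eta> \<in> Conf X"
  unfolding Conf_def by (auto simp: Int_Un_distrib2)

text \<open>Union of sets agrees with addition of point measures only when no point is shared; every
  later superposition argument has to secure this disjointness.\<close>

lemma conf_sum_Un:
  assumes "\<phi> \<in> Cc X" "\<gamma> \<in> Conf X" "\<eta> \<in> Conf X" "\<gamma> \<inter> \<eta> = {}"
  shows "conf_sum \<phi> (\<gamma> \<union> \<eta>) = conf_sum \<phi> \<gamma> + conf_sum \<phi> \<eta>"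
proof -
  obtain K where K: "compactin X K" "\<forall>x\<in>topspace X - K. \<phi> x = 0"
    using assms(1) unfolding Cc_def by auto
  have *: "conf_sum \<phi> A = (\<Sum>x\<in>A \<inter> K. \<phi> x)" if "A \<in> Conf X" for A
    using that K by (intro conf_sum_eq) (auto simp: Conf_def)
  have "finite (\<gamma> \<inter> K)" "finite (\<eta> \<inter> K)" using assms K by (auto simp: Conf_def)
  then show ?thesis
    using assms by (simp add: * Conf_Un Int_Un_distrib2) (rule sum.union_disjoint; auto)
qed

text \<open>Local compactness, the Hausdorff property and second countability enter through one
  enumerated base of relatively compact open sets. Having closures inside \<open>U\<close> builds in
  regularity, and indexing by numbers keeps the neighbourhood systems below countable.\<close>

locale lc_base =
  fixes X :: "'a topology" and b :: "nat \<Rightarrow> 'a set"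
  assumes Haus: "Hausdorff_space X" and lc: "locally_compact_space X"
    and open_b: "\<And>n. openin X (b n)"
    and compact_b: "\<And>n. compactin X (X closure_of b n)"
    and base: "\<And>U x. openin X U \<Longrightarrow> x \<in> U \<Longrightarrow> \<exists>n. x \<in> b n \<and> X closure_of b n \<subseteq> U"
begin

text \<open>A countable compact exhaustion. The strict bound makes \<open>K 0\<close> empty, so that
  the differences of consecutive \<open>K k\<close> partition each \<open>K k\<close>.\<close>

definition K :: "nat \<Rightarrow> 'a set" where "K k = (\<Union>i<k. X closure_of b i)"

lemma compact_K: "compactin X (K k)"
  unfolding K_def using compact_b by (intro compactin_Union) auto

lemma closed_K: "closedin X (K k)"
  using compact_K Haus compactin_imp_closedin by blast

lemma K_mono: "i \<le> j \<Longrightarrow> K i \<subseteq> K j"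
  unfolding K_def by (rule UN_mono) auto

lemma K_topspace: "K k \<subseteq> topspace X"
  using compact_K compactin_subset_topspace by blast

lemma b_topspace: "b n \<subseteq> topspace X"
  using open_b openin_subset by blast

text \<open>Finitely many base sets cover a compact set, so quantification over all compact sets can
  be replaced by quantification over the sequence \<open>K\<close>.\<close>

lemma compact_subset_K:
  assumes "compactin X C" shows "\<exists>k. C \<subseteq> K k"
proof -
  have "C \<subseteq> \<Union>(range b)" 
    using base[of "topspace X"] compactin_subset_topspace[OF assms] by fastforce
  moreover have "\<forall>U\<in>range b. openin X U" using open_b by blast
  ultimately obtain \<F> where F: "finite \<F>" "\<F> \<subseteq> range b" "C \<subseteq> \<Union>\<F>"
    using assms unfolding compactin_def by meson
  then obtain N where N: "finite N" "\<F> = b ` N" by (meson finite_subset_image)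
  obtain k where k: "\<forall>n\<in>N. n < k" using N(1) finite_nat_set_iff_bounded by auto
  have "b n \<subseteq> K k" if "n \<in> N" for n
  proof -
    have "X closure_of b n \<subseteq> K k" unfolding K_def by (rule UN_upper) (use k that in simp)
    then show ?thesis using closure_of_subset[OF b_topspace] by (rule order_trans[rotated])
  qed
  then have "C \<subseteq> K k" using F(3) unfolding N(2) by blast
  then show ?thesis ..
qed

lemma in_K: "x \<in> topspace X \<Longrightarrow> \<exists>k. x \<in> K k"
  using compact_subset_K[of "{x}"] by simp

lemma Conf_iff: "\<gamma> \<in> Conf X \<longleftrightarrow> \<gamma> \<subseteq> topspace X \<and> (\<forall>k. finite (\<gamma> \<inter> K k))"
proof -
  have "finite (\<gamma> \<inter> C)" if fin: "\<forall>k. finite (\<gamma> \<inter> K k)" and C: "compactin X C" for C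
  proof -
    obtain k where "C \<subseteq> K k" using compact_subset_K[OF C] by blast
    then show ?thesis using fin by (auto intro: finite_subset[of "\<gamma> \<inter> C" "\<gamma> \<inter> K k"])
  qed
  then show ?thesis unfolding Conf_def using compact_K by auto
qed

lemma countable_Conf: "\<gamma> \<in> Conf X \<Longrightarrow> countable \<gamma>"
proof -
  assume "\<gamma> \<in> Conf X"
  then have "\<gamma> = (\<Union>k. \<gamma> \<inter> K k)" "\<And>k. finite (\<gamma> \<inter> K k)"
    using in_K by (auto simp: Conf_iff)
  moreover have "countable (\<Union>k. \<gamma> \<inter> K k)"
    using calculation(2) by (intro countable_UN) (auto intro: countable_finite)
  ultimately show ?thesis by simp
qed

lemma compact_neighbourhood:
  assumes "compactin X C"
  obtains U L where "openin X U" "compactin X L" "C \<subseteq> U" "U \<subseteq> L"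
proof -
  have "\<forall>K. compactin X K \<longrightarrow> (\<exists>U L. openin X U \<and> compactin X L \<and> closedin X L \<and> K \<subseteq> U \<and> U \<subseteq> L)"
    using locally_compact_space_compact_closed_compact[of X] lc Haus by simp
  then show ?thesis using assms that by blast
qed

text \<open>A Urysohn function for \<open>C\<close> against the complement of
  \<open>U \<inter> V\<close>, where \<open>V\<close> is a relatively compact neighbourhood of
  \<open>C\<close>; intersecting with \<open>V\<close> is what produces compact support.\<close>

lemma bump:
  assumes "compactin X C" "openin X U" "C \<subseteq> U"
  obtains \<phi> where "\<phi> \<in> Cc X" "\<And>x. x \<in> topspace X \<Longrightarrow> 0 \<le> \<phi> x \<and> \<phi> x \<le> 1"
    "\<And>x. x \<in> C \<Longrightarrow> \<phi> x = 1" "\<And>x. x \<in> topspace X \<Longrightarrow> x \<notin> U \<Longrightarrow> \<phi> x = 0"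
proof -
  have reg: "completely_regular_space X"
    using locally_compact_regular_imp_completely_regular_space[OF lc] Haus by simp
  obtain V L where V: "openin X V" "compactin X L" "C \<subseteq> V" "V \<subseteq> L"
    using compact_neighbourhood[OF assms(1)] .
  have "closedin X (topspace X - U \<inter> V)" "disjnt C (topspace X - U \<inter> V)"
    using assms V by (auto simp: disjnt_def)
  then obtain f where f: "continuous_map X (top_of_set {0..1::real}) f"
      "f ` (topspace X - U \<inter> V) \<subseteq> {0}" "f ` C \<subseteq> {1}"
    by (rule Urysohn_completely_regular_compact_closed[OF zero_le_one reg assms(1)])
  show thesis
  proof
    have "\<forall>x\<in>topspace X - L. f x = 0" using f(2) V by blast
    moreover have "continuous_map X euclideanreal f"
      using f(1) continuous_map_into_fulltopology by blast
    ultimately show "f \<in> Cc X" unfolding Cc_def using V by blast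
    show "0 \<le> f x \<and> f x \<le> 1" if "x \<in> topspace X" for x
      using f(1) that by (auto simp: continuous_map_in_subtopology)
    show "f x = 1" if "x \<in> C" for x using f(3) that by auto
    show "f x = 0" if "x \<in> topspace X" "x \<notin> U" for x using f(2) that by auto
  qed
qed

end

lemma lc_base_exists:
  assumes "locally_compact_space X" "second_countable X" "Hausdorff_space X"
  shows "\<exists>b. lc_base X b"
proof -
  obtain \<B> where B: "countable \<B>" "\<And>V. V \<in> \<B> \<Longrightarrow> openin X V"
      "\<And>U x. openin X U \<Longrightarrow> x \<in> U \<Longrightarrow> \<exists>V\<in>\<B>. x \<in> V \<and> V \<subseteq> U"
    using assms(2) unfolding second_countable_def by metis
  \<comment> \<open>The empty set is added to make the family nonempty, so that
    \<open>from_nat_into\<close> enumerates exactly \<open>\<C>\<close>.\<close>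
  define \<C> where "\<C> = insert {} {V \<in> \<B>. compactin X (X closure_of V)}"
  have C: "countable \<C>" "\<C> \<noteq> {}" using B(1) by (auto simp: \<C>_def)
  define b where "b = from_nat_into \<C>"
  have rb: "range b = \<C>" unfolding b_def by (rule range_from_nat_into[OF C(2) C(1)])
  have nb: "neighbourhood_base_of (\<lambda>C. compactin X C \<and> closedin X C) X"
    using locally_compact_space_neighbourhood_base_closedin assms by blast
  have "lc_base X b"
  proof
    fix n
    have "b n \<in> \<C>" using rb by auto
    then show "openin X (b n)" "compactin X (X closure_of b n)" using B by (auto simp: \<C>_def)
  next
    fix U x assume U: "openin X U" "x \<in> U"
    then obtain V C where V: "openin X V" "compactin X C" "closedin X C" "x \<in> V" "V \<subseteq> C" "C \<subseteq> U"
      using nb unfolding neighbourhood_base_of by meson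
    then obtain B where B': "B \<in> \<B>" "x \<in> B" "B \<subseteq> V" using B(3) by blast
    have cl: "X closure_of B \<subseteq> C" using B' V by (meson closure_of_minimal order_trans)
    then have "compactin X (X closure_of B)"
      using V(2) closed_compactin closedin_closure_of by blast
    then have "B \<in> \<C>" using B' by (auto simp: \<C>_def)
    then obtain n where "b n = B" using rb by auto
    then show "\<exists>n. x \<in> b n \<and> X closure_of b n \<subseteq> U" using B' cl V by blast
  qed (use assms in auto)
  then show ?thesis by blast
qed

section \<open>Neighbourhoods of a configuration\<close>

lemma Hausdorff_finite_separation:
  assumes "Hausdorff_space X" "finite S" "S \<subseteq> topspace X"
  obtains D where "\<And>x. x \<in> S \<Longrightarrow> openin X (D x)" "\<And>x. x \<in> S \<Longrightarrow> x \<in> D x"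
    "\<And>x y. x \<in> S \<Longrightarrow> y \<in> S \<Longrightarrow> x \<noteq> y \<Longrightarrow> D x \<inter> D y = {}"
proof -
  have "\<exists>U V. openin X U \<and> openin X V \<and> x \<in> U \<and> y \<in> V \<and> U \<inter> V = {}"
    if "x \<in> S" "y \<in> S" "x \<noteq> y" for x y
    using assms that unfolding Hausdorff_space_def disjnt_def by (meson subsetD)
  then obtain U V where UV: "\<And>x y. x \<in> S \<Longrightarrow> y \<in> S \<Longrightarrow> x \<noteq> y \<Longrightarrow>
      openin X (U x y) \<and> openin X (V x y) \<and> x \<in> U x y \<and> y \<in> V x y \<and> U x y \<inter> V x y = {}"
    by metis
  \<comment> \<open>The separating sets chosen for \<open>(x, y)\<close> and for
    \<open>(y, x)\<close> are unrelated. Hence \<open>D x\<close> takes the first set of the former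
    and the second set of the latter, so that both \<open>D x\<close> and \<open>D y\<close> lie on
    opposite sides of one common pair.\<close>
  define D where "D x = topspace X \<inter> \<Inter> ((\<lambda>y. U x y \<inter> V y x) ` (S - {x}))" for x
  show thesis
  proof
    fix x assume x: "x \<in> S"
    show "openin X (D x)"
      unfolding D_def using x assms(2) UV by (intro openin_Int_Inter) auto
    show "x \<in> D x" unfolding D_def using x assms(3) UV by auto
    fix y assume y: "y \<in> S" "x \<noteq> y"
    have "D x \<subseteq> U x y" "D y \<subseteq> V x y" unfolding D_def using x y by auto
    then show "D x \<inter> D y = {}" using UV[OF x y] by blast
  qed
qed

lemma conf_sum_indicator:
  assumes "\<And>y. y \<in> \<gamma> \<Longrightarrow> \<phi> y = (if y \<in> B then 1 else 0)"
  shows "conf_sum \<phi> \<gamma> = real (card (\<gamma> \<inter> B))"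
proof -
  have "{x \<in> \<gamma>. \<phi> x \<noteq> 0} = \<gamma> \<inter> B" using assms by (auto split: if_splits)
  then show ?thesis unfolding conf_sum_def using assms by simp
qed

context lc_base
begin

lemma conf_sum_K:
  assumes "\<phi> \<in> Cc X"
  obtains k where "\<And>x. x \<in> topspace X \<Longrightarrow> \<phi> x \<noteq> 0 \<Longrightarrow> x \<in> K k"
    "\<And>\<gamma>. \<gamma> \<in> Conf X \<Longrightarrow> conf_sum \<phi> \<gamma> = (\<Sum>x\<in>\<gamma> \<inter> K k. \<phi> x)"
proof -
  obtain L where L: "compactin X L" "\<forall>x\<in>topspace X - L. \<phi> x = 0"
    using assms unfolding Cc_def by auto
  obtain k where k: "L \<subseteq> K k" using compact_subset_K L by blast
  show thesis
  proof
    show 1: "x \<in> K k" if "x \<in> topspace X" "\<phi> x \<noteq> 0" for x using that L k by blast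
    show "conf_sum \<phi> \<gamma> = (\<Sum>x\<in>\<gamma> \<inter> K k. \<phi> x)" if "\<gamma> \<in> Conf X" for \<gamma>
      using that 1 by (intro conf_sum_eq) (auto simp: Conf_iff)
  qed
qed

lemma le_conf_sum:
  assumes "\<phi> \<in> Cc X" "\<gamma> \<in> Conf X" "\<And>x. x \<in> topspace X \<Longrightarrow> 0 \<le> \<phi> x" "y \<in> \<gamma>"
  shows "\<phi> y \<le> conf_sum \<phi> \<gamma>"
proof -
  obtain k where k: "\<And>x. x \<in> topspace X \<Longrightarrow> \<phi> x \<noteq> 0 \<Longrightarrow> x \<in> K k"
    "\<And>\<gamma>. \<gamma> \<in> Conf X \<Longrightarrow> conf_sum \<phi> \<gamma> = (\<Sum>x\<in>\<gamma> \<inter> K k. \<phi> x)"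
    using conf_sum_K[OF assms(1)] by metis
  have sub: "\<gamma> \<subseteq> topspace X" "finite (\<gamma> \<inter> K k)" using assms(2) by (auto simp: Conf_iff)
  have nn: "0 \<le> (\<Sum>x\<in>\<gamma> \<inter> K k. \<phi> x)" using assms sub by (intro sum_nonneg) auto
  show ?thesis
  proof (cases "\<phi> y = 0")
    case False
    then have "y \<in> \<gamma> \<inter> K k" using k assms(4) sub by auto
    then show ?thesis
      unfolding k(2)[OF assms(2)] using sub assms(3) by (intro member_le_sum) auto
  qed (use nn k(2)[OF assms(2)] in simp)
qed

text \<open>\<open>N\<close> assigns to each point of \<open>\<gamma> \<inter> K k\<close> the index of its neighbourhood in the base. The last two
  conditions make the neighbourhoods shrink as \<open>k\<close> grows and keep points outside \<open>K j\<close> from being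
  approximated by points of \<open>K j\<close>.\<close>

definition cells :: "'a set \<Rightarrow> nat \<Rightarrow> ('a \<Rightarrow> nat) \<Rightarrow> bool" where
  "cells \<gamma> k N \<longleftrightarrow> (\<forall>x\<in>\<gamma> \<inter> K k. x \<in> b (N x) \<and> X closure_of b (N x) \<inter> \<gamma> = {x} \<and>
     (\<forall>y\<in>\<gamma> \<inter> K k. y \<noteq> x \<longrightarrow> b (N x) \<inter> b (N y) = {}) \<and>
     (\<forall>j\<le>k. x \<notin> K j \<longrightarrow> b (N x) \<inter> K j = {}) \<and> (\<forall>i\<le>k. x \<in> b i \<longrightarrow> b (N x) \<subseteq> b i))"

text \<open>Parametrised by \<open>k\<close> and base indices instead of by a configuration, so that
  only countably many of these sets have finite \<open>I\<close>. They are not claimed to be open: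
  \<open>W_neighbourhood\<close> places an open set inside.\<close>

definition W :: "nat \<Rightarrow> nat set \<Rightarrow> 'a set set" where
  "W k I = {\<gamma> \<in> Conf X. \<gamma> \<inter> (K k - (\<Union>n\<in>I. b n)) = {} \<and> (\<forall>n\<in>I. card (\<gamma> \<inter> b n) = 1)}"

lemma b_closure: "b n \<subseteq> X closure_of b n"
  by (rule closure_of_subset[OF b_topspace])

lemma finite_closedin: "finite S \<Longrightarrow> S \<subseteq> topspace X \<Longrightarrow> closedin X S"
  using Haus closedin_Hausdorff_finite by blast

text \<open>Each requirement on the cell of \<open>x\<close> restricts it to an open neighbourhood
  of \<open>x\<close>, and only finitely many requirements are imposed at level
  \<open>k\<close>.\<close>

lemma cells_exists:
  assumes g: "\<gamma> \<in> Conf X"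
  shows "\<exists>N. cells \<gamma> k N"
proof -
  have fin: "finite (\<gamma> \<inter> K k)" and sub: "\<gamma> \<subseteq> topspace X" using g by (auto simp: Conf_iff)
  obtain D where D: "\<And>x. x \<in> \<gamma> \<inter> K k \<Longrightarrow> openin X (D x)" "\<And>x. x \<in> \<gamma> \<inter> K k \<Longrightarrow> x \<in> D x"
    "\<And>x y. x \<in> \<gamma> \<inter> K k \<Longrightarrow> y \<in> \<gamma> \<inter> K k \<Longrightarrow> x \<noteq> y \<Longrightarrow> D x \<inter> D y = {}"
    using Hausdorff_finite_separation[OF Haus fin] sub by (metis le_infI1)
  have "\<exists>n. x \<in> b n \<and> X closure_of b n \<subseteq> D x \<and> X closure_of b n \<inter> \<gamma> = {x} \<and>
     (\<forall>j\<le>k. x \<notin> K j \<longrightarrow> b n \<inter> K j = {}) \<and> (\<forall>i\<le>k. x \<in> b i \<longrightarrow> b n \<subseteq> b i)"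
    if x: "x \<in> \<gamma> \<inter> K k" for x
  proof -
    obtain U L where UL: "openin X U" "compactin X L" "{x} \<subseteq> U" "U \<subseteq> L"
      by (rule compact_neighbourhood[of "{x}"]) (use x sub in auto)
    have finL: "finite (\<gamma> \<inter> L - {x})" using g UL by (auto simp: Conf_def)
    \<comment> \<open>\<open>D x\<close> yields disjoint cells. Inside \<open>U\<close>, all points
      of \<open>\<gamma>\<close> lie in \<open>L\<close>, so deleting the finite set
      \<open>\<gamma> \<inter> L - {x}\<close> isolates \<open>x\<close> in
      \<open>\<gamma>\<close>.\<close>
    define G where "G = (D x \<inter> U - (\<gamma> \<inter> L - {x}))
       \<inter> \<Inter> ((\<lambda>j. topspace X - K j) ` {j. j \<le> k \<and> x \<notin> K j} \<union> b ` {i. i \<le> k \<and> x \<in> b i})"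
    have "openin X (D x \<inter> U - (\<gamma> \<inter> L - {x}))"
      using D(1)[OF x] UL finL sub by (intro openin_diff openin_Int finite_closedin) auto
    then have "openin X G"
      unfolding G_def using closed_K open_b
      by (intro openin_Int_Inter) (auto intro: openin_diff)
    moreover have "x \<in> G" unfolding G_def using D(2)[OF x] UL x sub by auto
    ultimately obtain n where n: "x \<in> b n" "X closure_of b n \<subseteq> G" using base by blast
    have "X closure_of b n \<inter> \<gamma> = {x}"
    proof -
      have "x \<in> X closure_of b n" using n b_closure by blast
      then show ?thesis using n UL x unfolding G_def by auto
    qed
    moreover have "b n \<subseteq> G" using n b_closure by blast
    ultimately show ?thesis using n unfolding G_def by (intro exI[of _ n]) blast
  qed
  then obtain N where N: "\<And>x. x \<in> \<gamma> \<inter> K k \<Longrightarrow>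
     x \<in> b (N x) \<and> X closure_of b (N x) \<subseteq> D x \<and> X closure_of b (N x) \<inter> \<gamma> = {x} \<and>
     (\<forall>j\<le>k. x \<notin> K j \<longrightarrow> b (N x) \<inter> K j = {}) \<and> (\<forall>i\<le>k. x \<in> b i \<longrightarrow> b (N x) \<subseteq> b i)"
    by metis
  have "b (N x) \<inter> b (N y) = {}" if "x \<in> \<gamma> \<inter> K k" "y \<in> \<gamma> \<inter> K k" "y \<noteq> x" for x y
  proof -
    have "b (N x) \<subseteq> D x" "b (N y) \<subseteq> D y"
      using N[OF that(1)] N[OF that(2)] b_closure order_trans by metis+
    then show ?thesis using D(3)[OF that(1,2)] that(3) by blast
  qed
  then have "cells \<gamma> k N" unfolding cells_def using N by simp
  then show ?thesis by (intro exI[of _ N])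
qed

text \<open>Two kinds of test functions force membership. A small sum of \<open>\<phi>\<close>
  excludes points from the part of the region away from the small sets \<open>V x\<close>; on what
  remains of a cell \<open>\<psi> x\<close> equals 1, so its sum is an exact count.\<close>

lemma W_neighbourhood:
  assumes g: "\<gamma> \<in> Conf X" and c: "cells \<gamma> k N"
  shows "\<exists>G. openin (vague X) G \<and> \<gamma> \<in> G \<and> G \<subseteq> W k (N ` (\<gamma> \<inter> K k))"
proof -
  define S where "S = \<gamma> \<inter> K k"
  have fin: "finite S" and sub: "\<gamma> \<subseteq> topspace X" using g by (auto simp: Conf_iff S_def)
  have c1: "x \<in> b (N x)" and c2: "X closure_of b (N x) \<inter> \<gamma> = {x}"
    and c3: "\<And>y. y \<in> S \<Longrightarrow> y \<noteq> x \<Longrightarrow> b (N x) \<inter> b (N y) = {}" if "x \<in> S" for x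
    using c that unfolding cells_def S_def by blast+
  have "\<exists>V L. openin X V \<and> compactin X L \<and> x \<in> V \<and> V \<subseteq> L \<and> L \<subseteq> b (N x)" if "x \<in> S" for x
  proof -
    have "neighbourhood_base_of (compactin X) X"
      using locally_compact_space_neighbourhood_base Haus lc by blast
    then show ?thesis
      using open_b[of "N x"] c1[OF that] unfolding neighbourhood_base_of by simp
  qed
  then obtain V L where VL: "\<And>x. x \<in> S \<Longrightarrow> openin X (V x) \<and> compactin X (L x) \<and> x \<in> V x \<and> V x \<subseteq> L x \<and> L x \<subseteq> b (N x)"
    by metis
  \<comment> \<open>The closures of the cells are included besides \<open>K k\<close>: a point of
    \<open>b (N x)\<close> outside \<open>V x\<close> could receive an intermediate value of
    \<open>\<psi> x\<close>, and a cell may stick out of \<open>K k\<close>.\<close>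
  define C where "C = (K k \<union> (\<Union>x\<in>S. X closure_of b (N x))) - (\<Union>x\<in>S. V x)"
  have "compactin X (K k \<union> (\<Union>x\<in>S. X closure_of b (N x)))"
    using fin compact_K compact_b by (intro compactin_Un compactin_Union) auto
  moreover have "closedin X C"
    unfolding C_def using VL fin closed_K by (intro closedin_diff closedin_Un closedin_Union openin_Union) auto
  ultimately have "compactin X C"
    using closed_compactin[of X _ C] unfolding C_def by blast
  then obtain U M where UM: "openin X U" "compactin X M" "C \<subseteq> U" "U \<subseteq> M"
    by (rule compact_neighbourhood)
  have C\<gamma>: "C \<inter> \<gamma> = {}"
  proof -
    have False if y: "y \<in> C" "y \<in> \<gamma>" for y
    proof -
      have "y \<in> S"
      proof (cases "y \<in> K k")
        case False
        then obtain x where x: "x \<in> S" "y \<in> X closure_of b (N x)" using y(1) unfolding C_def by blast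
        then have "y \<in> {x}" using c2[OF x(1)] y(2) by blast
        then show ?thesis using x(1) by simp
      qed (use y(2) in \<open>simp add: S_def\<close>)
      then have "y \<in> (\<Union>x\<in>S. V x)" using VL by blast
      then show False using y(1) unfolding C_def by blast
    qed
    then show ?thesis by blast
  qed
  have "finite (\<gamma> \<inter> M)" using g UM by (auto simp: Conf_def)
  \<comment> \<open>Deleting the finitely many points of \<open>\<gamma>\<close> in \<open>M\<close>
    from the support region makes the sum of \<open>\<phi>\<close> over \<open>\<gamma>\<close>
    equal to 0.\<close>
  then have "openin X (U - (\<gamma> \<inter> M))" using UM sub by (intro openin_diff finite_closedin) auto
  moreover have "C \<subseteq> U - (\<gamma> \<inter> M)" using C\<gamma> UM by blast
  ultimately obtain \<phi> where \<phi>: "\<phi> \<in> Cc X" "\<And>x. x \<in> topspace X \<Longrightarrow> 0 \<le> \<phi> x \<and> \<phi> x \<le> 1"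
    "\<And>x. x \<in> C \<Longrightarrow> \<phi> x = 1" "\<And>x. x \<in> topspace X \<Longrightarrow> x \<notin> U - (\<gamma> \<inter> M) \<Longrightarrow> \<phi> x = 0"
    using bump[OF \<open>compactin X C\<close>] by metis
  have "\<exists>\<psi>. \<psi> \<in> Cc X \<and> (\<forall>y\<in>L x. \<psi> y = 1) \<and> (\<forall>y\<in>topspace X - b (N x). \<psi> y = 0)" if "x \<in> S" for x
  proof -
    have "compactin X (L x)" "L x \<subseteq> b (N x)" using VL that by auto
    then show ?thesis by (rule bump[OF _ open_b]) auto
  qed
  then obtain \<psi> where \<psi>: "\<And>x. x \<in> S \<Longrightarrow> \<psi> x \<in> Cc X \<and> (\<forall>y\<in>L x. \<psi> x y = 1) \<and> (\<forall>y\<in>topspace X - b (N x). \<psi> x y = 0)"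
    by metis
  \<comment> \<open>At \<open>\<gamma>\<close> the sums are 0 and 1. The thresholds isolate these
    two values: once the sums are known to be counts, they must keep them.\<close>
  define G where "G = {\<eta> \<in> Conf X. conf_sum \<phi> \<eta> \<in> {..<1/2}}
      \<inter> \<Inter> ((\<lambda>x. {\<eta> \<in> Conf X. conf_sum (\<psi> x) \<eta> \<in> {1/2<..<3/2}}) ` S)"
  have "openin (vague X) G"
  proof -
    have "openin (vague X) {\<eta> \<in> Conf X. conf_sum \<phi> \<eta> \<in> {..<1/2}}"
      by (rule openin_vague_conf_sum[OF \<phi>(1)]) auto
    moreover have "openin (vague X) {\<eta> \<in> Conf X. conf_sum (\<psi> x) \<eta> \<in> {1/2<..<3/2}}" if "x \<in> S" for x
      using \<psi>[OF that] by (intro openin_vague_conf_sum) auto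
    ultimately show ?thesis unfolding G_def using fin by (intro openin_Int_Inter) auto
  qed
  moreover have "\<gamma> \<in> G"
  proof -
    have "conf_sum \<phi> \<gamma> = real (card (\<gamma> \<inter> {}))"
      using \<phi>(4) sub UM by (intro conf_sum_indicator) auto
    moreover have "conf_sum (\<psi> x) \<gamma> = real (card (\<gamma> \<inter> {x}))" if x: "x \<in> S" for x
    proof (rule conf_sum_indicator)
      fix y assume y: "y \<in> \<gamma>"
      have "\<psi> x x = 1" using \<psi> VL x by blast
      moreover have "\<psi> x y = 0" if "y \<noteq> x"
        using \<psi>[OF x] c2[OF x] y that sub b_closure by blast
      ultimately show "\<psi> x y = (if y \<in> {x} then 1 else 0)" by auto
    qed
    moreover have "\<gamma> \<inter> {x} = {x}" if "x \<in> S" for x using that by (auto simp: S_def)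
    ultimately show ?thesis unfolding G_def using g by auto
  qed
  moreover have "G \<subseteq> W k (N ` S)"
  proof
    fix \<eta> assume e: "\<eta> \<in> G"
    then have eC: "\<eta> \<in> Conf X" and esub: "\<eta> \<subseteq> topspace X" by (auto simp: G_def Conf_def)
    have miss: "y \<notin> \<eta>" if "y \<in> C" for y
    proof
      assume "y \<in> \<eta>"
      then have "\<phi> y \<le> conf_sum \<phi> \<eta>" using le_conf_sum[OF \<phi>(1) eC] \<phi>(2) by blast
      then show False using \<phi>(3)[OF that] e by (auto simp: G_def)
    qed
    have 1: "\<eta> \<inter> (K k - (\<Union>n\<in>N ` S. b n)) = {}"
    proof -
      have "K k - (\<Union>n\<in>N ` S. b n) \<subseteq> C" unfolding C_def using VL by blast
      then show ?thesis using miss by blast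
    qed
    have 2: "card (\<eta> \<inter> b (N x)) = 1" if x: "x \<in> S" for x
    proof -
      have "conf_sum (\<psi> x) \<eta> = real (card (\<eta> \<inter> b (N x)))"
      proof (rule conf_sum_indicator)
        fix y assume y: "y \<in> \<eta>"
        have "\<psi> x y = 1" if "y \<in> b (N x)"
        proof -
          have "y \<notin> C" using miss y by blast
          moreover have "y \<in> (\<Union>x\<in>S. X closure_of b (N x))"
            using subsetD[OF b_closure that] x by blast
          ultimately obtain x' where x': "x' \<in> S" "y \<in> V x'" unfolding C_def by blast
          moreover have "y \<in> b (N x')" using VL[OF x'(1)] x'(2) by blast
          ultimately have "x' = x" using c3[OF x x'(1)] that by blast
          then have "y \<in> L x" using VL[OF x] x'(2) by blast
          then show ?thesis using \<psi>[OF x] by simp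
        qed
        moreover have "\<psi> x y = 0" if "y \<notin> b (N x)" using \<psi>[OF x] that y esub by blast
        ultimately show "\<psi> x y = (if y \<in> b (N x) then 1 else 0)" by auto
      qed
      moreover have "conf_sum (\<psi> x) \<eta> \<in> {1/2<..<3/2}" using e x by (auto simp: G_def)
      ultimately show ?thesis by simp
    qed
    show "\<eta> \<in> W k (N ` S)" unfolding W_def using eC 1 2 by simp
  qed
  ultimately show ?thesis unfolding S_def by (intro exI[of _ G] conjI)
qed

text \<open>The label of \<open>y\<close>: the point of \<open>\<gamma>\<close> matched with it if there is one, otherwise \<open>y\<close> itself.\<close>

definition tau :: "'a set \<Rightarrow> nat \<Rightarrow> ('a \<Rightarrow> nat) \<Rightarrow> 'a \<Rightarrow> 'a" where
  "tau \<gamma> k N y = (if \<exists>x\<in>\<gamma> \<inter> K k. y \<in> b (N x) then THE x. x \<in> \<gamma> \<inter> K k \<and> y \<in> b (N x) else y)"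

lemma tau_in:
  assumes "cells \<gamma> k N" "x \<in> \<gamma> \<inter> K k" "y \<in> b (N x)"
  shows "tau \<gamma> k N y = x"
proof -
  have "(THE x. x \<in> \<gamma> \<inter> K k \<and> y \<in> b (N x)) = x"
  proof (rule the_equality)
    fix z assume z: "z \<in> \<gamma> \<inter> K k \<and> y \<in> b (N z)"
    show "z = x"
    proof (rule ccontr)
      assume "z \<noteq> x"
      then have "b (N x) \<inter> b (N z) = {}" using assms(1,2) z unfolding cells_def by blast
      then show False using assms(3) z by blast
    qed
  qed (use assms in blast)
  moreover have "\<exists>x\<in>\<gamma> \<inter> K k. y \<in> b (N x)" using assms by blast
  ultimately show ?thesis unfolding tau_def by simp
qed

lemma tau_out: "(\<And>x. x \<in> \<gamma> \<inter> K k \<Longrightarrow> y \<notin> b (N x)) \<Longrightarrow> tau \<gamma> k N y = y"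
  unfolding tau_def by metis

text \<open>Matched points have labels in \<open>K k\<close>, while unmatched points of
  \<open>\<eta>\<close> lie outside \<open>K k\<close> and label themselves, so the two kinds never
  collide. Two matched points with one label would share a cell that contains a single
  point.\<close>

lemma inj_on_tau:
  assumes c: "cells \<gamma> k N" and w: "\<eta> \<in> W k (N ` (\<gamma> \<inter> K k))"
  shows "inj_on (tau \<gamma> k N) \<eta>"
proof -
  have out: "tau \<gamma> k N y = y \<and> y \<notin> K k" if "y \<in> \<eta>" "\<not> (\<exists>x\<in>\<gamma> \<inter> K k. y \<in> b (N x))" for y
    using tau_out[of \<gamma> k y N] w that unfolding W_def by blast
  have inn: "\<exists>x\<in>\<gamma> \<inter> K k. \<eta> \<inter> b (N x) = {y} \<and> tau \<gamma> k N y = x"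
    if y: "y \<in> \<eta>" "\<exists>x\<in>\<gamma> \<inter> K k. y \<in> b (N x)" for y
  proof -
    obtain x where x: "x \<in> \<gamma> \<inter> K k" "y \<in> b (N x)" using y by blast
    then have "card (\<eta> \<inter> b (N x)) = 1" using w unfolding W_def by blast
    then obtain z where "\<eta> \<inter> b (N x) = {z}" by (rule card_1_singletonE)
    then have "\<eta> \<inter> b (N x) = {y}" using x y by (metis IntI singletonD)
    then show ?thesis using x tau_in[OF c x] by blast
  qed
  show ?thesis
  proof (rule inj_onI)
    fix y z assume yz: "y \<in> \<eta>" "z \<in> \<eta>" "tau \<gamma> k N y = tau \<gamma> k N z"
    show "y = z"
    proof (cases "\<exists>x\<in>\<gamma> \<inter> K k. y \<in> b (N x)"; cases "\<exists>x\<in>\<gamma> \<inter> K k. z \<in> b (N x)")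
      assume "\<exists>x\<in>\<gamma> \<inter> K k. y \<in> b (N x)" "\<exists>x\<in>\<gamma> \<inter> K k. z \<in> b (N x)"
      then have "\<eta> \<inter> b (N (tau \<gamma> k N y)) = {y}" "\<eta> \<inter> b (N (tau \<gamma> k N z)) = {z}"
        using inn yz by blast+
      then have "{y} = {z}" unfolding yz(3) by (rule trans[OF sym])
      then show "y = z" by (rule singleton_inject)
    next
      assume "\<exists>x\<in>\<gamma> \<inter> K k. y \<in> b (N x)" "\<not> (\<exists>x\<in>\<gamma> \<inter> K k. z \<in> b (N x))"
      then have "tau \<gamma> k N y \<in> K k" "tau \<gamma> k N z \<notin> K k" using inn[OF yz(1)] out[OF yz(2)] by auto
      then show "y = z" unfolding yz(3) by (rule notE[rotated])
    next
      assume "\<not> (\<exists>x\<in>\<gamma> \<inter> K k. y \<in> b (N x))" "\<exists>x\<in>\<gamma> \<inter> K k. z \<in> b (N x)"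
      then have "tau \<gamma> k N y \<notin> K k" "tau \<gamma> k N z \<in> K k" using out[OF yz(1)] inn[OF yz(2)] by auto
      then show "y = z" unfolding yz(3) by (rule notE)
    next
      assume "\<not> (\<exists>x\<in>\<gamma> \<inter> K k. y \<in> b (N x))" "\<not> (\<exists>x\<in>\<gamma> \<inter> K k. z \<in> b (N x))"
      then have "tau \<gamma> k N y = y" "tau \<gamma> k N z = z" using out yz by blast+
      then show "y = z" unfolding yz(3) by (rule trans[OF sym])
    qed
  qed
qed

text \<open>The field \<open>\<omega>\<close> is fixed, so this is deterministic. From
  \<open>k0\<close> on, both sums run over the same finite set \<open>S\<close> of retained points
  of \<open>\<gamma>\<close>, with \<open>x\<close> replaced by its partner \<open>p k x\<close> on
  the left; it remains that \<open>p k x\<close> tends to \<open>x\<close>.\<close>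

lemma conf_sum_thinning_tendsto:
  assumes g: "\<gamma> \<in> Conf X" and c: "\<And>k. cells \<gamma> k (N k)"
    and w: "\<And>k. g k \<in> W k (N k ` (\<gamma> \<inter> K k))" and \<phi>: "\<phi> \<in> Cc X"
  shows "(\<lambda>k. conf_sum \<phi> {y \<in> g k. \<omega> (tau \<gamma> k (N k) y)}) \<longlonglongrightarrow> conf_sum \<phi> {x \<in> \<gamma>. \<omega> x}"
proof -
  have sub: "\<gamma> \<subseteq> topspace X" using g by (auto simp: Conf_iff)
  have gC: "g k \<in> Conf X" "g k \<subseteq> topspace X" for k using w[of k] by (auto simp: W_def Conf_def)
  obtain k0 where k0: "\<And>x. x \<in> topspace X \<Longrightarrow> \<phi> x \<noteq> 0 \<Longrightarrow> x \<in> K k0"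
    "\<And>\<gamma>. \<gamma> \<in> Conf X \<Longrightarrow> conf_sum \<phi> \<gamma> = (\<Sum>x\<in>\<gamma> \<inter> K k0. \<phi> x)"
    using conf_sum_K[OF \<phi>] by metis
  define S where "S = {x \<in> \<gamma>. \<omega> x} \<inter> K k0"
  have fin: "finite S" using g by (auto simp: S_def Conf_iff intro: finite_subset[of _ "\<gamma> \<inter> K k0"])
  define p where "p k x = (THE y. y \<in> g k \<inter> b (N k x))" for k x
  have p: "g k \<inter> b (N k x) = {p k x}" if "x \<in> \<gamma> \<inter> K k" for k x
  proof -
    have "card (g k \<inter> b (N k x)) = 1" using w[of k] that unfolding W_def by blast
    then obtain z where z: "g k \<inter> b (N k x) = {z}" by (rule card_1_singletonE)
    then show ?thesis unfolding p_def by simp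
  qed
  have SK: "x \<in> \<gamma> \<inter> K k" if "x \<in> S" "k0 \<le> k" for x k
    using that K_mono[OF that(2)] by (auto simp: S_def)
  have taup: "tau \<gamma> k (N k) (p k x) = x" if "x \<in> S" "k0 \<le> k" for x k
    using tau_in[OF c[of k] SK[OF that]] p[OF SK[OF that]] by blast
  have ev: "conf_sum \<phi> {y \<in> g k. \<omega> (tau \<gamma> k (N k) y)} = (\<Sum>x\<in>S. \<phi> (p k x))" if k: "k0 \<le> k" for k
  proof -
    let ?A = "{y \<in> g k. \<omega> (tau \<gamma> k (N k) y)}"
    have "conf_sum \<phi> ?A = (\<Sum>y\<in>?A \<inter> p k ` S. \<phi> y)"
    proof (rule conf_sum_eq)
      fix y assume y: "y \<in> ?A" "y \<notin> p k ` S"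
      show "\<phi> y = 0"
      proof (rule ccontr)
        assume "\<phi> y \<noteq> 0"
        then have yK: "y \<in> K k0" using k0 y gC by blast
        then have "y \<in> K k" using K_mono[OF k] by blast
        then obtain x where x: "x \<in> \<gamma> \<inter> K k" "y \<in> b (N k x)" using y w[of k] unfolding W_def by blast
        \<comment> \<open>If \<open>x\<close> were outside \<open>K k0\<close>, its cell would avoid
          \<open>K k0\<close> and could not contain \<open>y\<close>. No mass thus enters the
          support of \<open>\<phi>\<close> from outside.\<close>
        then have "x \<in> K k0" using c[of k] k yK unfolding cells_def by blast
        moreover have "\<omega> x" using y tau_in[OF c x] by auto
        ultimately have "x \<in> S" using x by (auto simp: S_def)
        moreover have "y = p k x" using p[OF x(1)] x y by blast
        ultimately show False using y by blast
      qed
    qed (use fin in auto)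
    also have "?A \<inter> p k ` S = p k ` S"
    proof -
      have "p k x \<in> ?A" if "x \<in> S" for x
        using p[OF SK[OF that k]] taup[OF that k] that by (auto simp: S_def)
      then show ?thesis by blast
    qed
    also have "(\<Sum>y\<in>p k ` S. \<phi> y) = (\<Sum>x\<in>S. \<phi> (p k x))"
      using taup k by (intro sum.reindex_cong[of "p k"] refl) (metis inj_onI)
    finally show ?thesis .
  qed
  have lim: "(\<lambda>k. \<phi> (p k x)) \<longlonglongrightarrow> \<phi> x" if x: "x \<in> S" for x
  proof (rule topological_tendstoI)
    fix V :: "real set" assume V: "open V" "\<phi> x \<in> V"
    have "openin X {y \<in> topspace X. \<phi> y \<in> V}"
      using \<phi> V by (auto simp: Cc_def continuous_map_def)
    then obtain i where i: "x \<in> b i" "X closure_of b i \<subseteq> {y \<in> topspace X. \<phi> y \<in> V}"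
      using base[of _ x] V x sub unfolding S_def by blast
    show "eventually (\<lambda>k. \<phi> (p k x) \<in> V) sequentially"
      using eventually_ge_at_top[of "max i k0"]
    proof eventually_elim
      case (elim k)
      then have "x \<in> \<gamma> \<inter> K k" using SK[OF x, of k] by simp
      moreover from this have "p k x \<in> b (N k x)" using p by blast
      \<comment> \<open>As soon as \<open>k\<close> reaches the index \<open>i\<close> of a base set
        around \<open>x\<close>, the cell of \<open>x\<close> is contained in that set; this is the
        shrinking of the cells.\<close>
      moreover have "b (N k x) \<subseteq> b i"
        using calculation(1) c[of k] elim i(1) unfolding cells_def by simp
      ultimately have "p k x \<in> b i" by blast
      then show ?case using i b_closure by blast
    qed
  qed
  have "(\<lambda>k. \<Sum>x\<in>S. \<phi> (p k x)) \<longlonglongrightarrow> (\<Sum>x\<in>S. \<phi> x)" by (intro tendsto_sum lim)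
  moreover have "eventually (\<lambda>k. conf_sum \<phi> {y \<in> g k. \<omega> (tau \<gamma> k (N k) y)} = (\<Sum>x\<in>S. \<phi> (p k x))) sequentially"
    using eventually_ge_at_top[of k0] by eventually_elim (rule ev)
  moreover have "conf_sum \<phi> {x \<in> \<gamma>. \<omega> x} = (\<Sum>x\<in>S. \<phi> x)"
    unfolding S_def by (rule k0(2)) (rule Conf_subset[OF g], auto)
  ultimately show ?thesis by (simp add: tendsto_cong)
qed

text \<open>Disjointness lets \<open>\<eta>\<close> contribute the same constant to every pairing,
  so only the thinned parts have to converge. No exceptional set of \<open>\<omega>\<close>
  arises.\<close>

lemma thinning_superposition_limit:
  assumes g: "\<gamma> \<in> Conf X" and c: "\<And>k. cells \<gamma> k (N k)"
    and w: "\<And>k. g k \<in> W k (N k ` (\<gamma> \<inter> K k))"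
    and e: "\<eta> \<in> Conf X" "\<eta> \<inter> \<gamma> = {}" "\<And>k. \<eta> \<inter> g k = {}"
  shows "limitin (vague X) (\<lambda>k. {y \<in> g k. \<omega> (tau \<gamma> k (N k) y)} \<union> \<eta>) ({x \<in> \<gamma>. \<omega> x} \<union> \<eta>) sequentially"
proof (rule limitin_vague)
  have gC: "g k \<in> Conf X" for k using w[of k] by (auto simp: W_def)
  have C: "{y \<in> g k. \<omega> (tau \<gamma> k (N k) y)} \<in> Conf X" "{x \<in> \<gamma>. \<omega> x} \<in> Conf X" for k
    by (rule Conf_subset[OF gC], auto, rule Conf_subset[OF g], auto)
  show "{x \<in> \<gamma>. \<omega> x} \<union> \<eta> \<in> Conf X" "{y \<in> g k. \<omega> (tau \<gamma> k (N k) y)} \<union> \<eta> \<in> Conf X" for k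
    using C e Conf_Un by blast+
  fix \<phi> assume \<phi>: "\<phi> \<in> Cc X"
  have 1: "conf_sum \<phi> ({y \<in> g k. \<omega> (tau \<gamma> k (N k) y)} \<union> \<eta>) =
      conf_sum \<phi> {y \<in> g k. \<omega> (tau \<gamma> k (N k) y)} + conf_sum \<phi> \<eta>" for k
    using e by (intro conf_sum_Un[OF \<phi>] C) auto
  have 2: "conf_sum \<phi> ({x \<in> \<gamma>. \<omega> x} \<union> \<eta>) = conf_sum \<phi> {x \<in> \<gamma>. \<omega> x} + conf_sum \<phi> \<eta>"
    using e by (intro conf_sum_Un[OF \<phi>] C) auto
  show "(\<lambda>k. conf_sum \<phi> ({y \<in> g k. \<omega> (tau \<gamma> k (N k) y)} \<union> \<eta>)) \<longlonglongrightarrow> conf_sum \<phi> ({x \<in> \<gamma>. \<omega> x} \<union> \<eta>)"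
    unfolding 1 2
    using tendsto_add[OF conf_sum_thinning_tendsto[OF g c w \<phi>, where \<omega> = \<omega>] tendsto_const] .
qed

text \<open>By contradiction, which avoids computing \<open>k\<close> from \<open>G\<close>: points
  \<open>g k\<close> chosen outside \<open>G\<close> in the successive neighbourhoods would converge
  to \<open>\<gamma>\<close>, yet \<open>G\<close> is open.\<close>

lemma W_base:
  assumes G: "openin (vague X) G" and \<gamma>: "\<gamma> \<in> G"
  shows "\<exists>k I. finite I \<and> \<gamma> \<in> W k I \<and> W k I \<subseteq> G"
proof (rule ccontr)
  assume neg: "\<not> ?thesis"
  have C: "\<gamma> \<in> Conf X" using openin_subset[OF G] \<gamma> by auto
  obtain N where N: "\<And>k. cells \<gamma> k (N k)" using cells_exists[OF C] by metis
  have fin: "finite (N k ` (\<gamma> \<inter> K k))" for k using C by (auto simp: Conf_iff)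
  have "\<gamma> \<in> W k (N k ` (\<gamma> \<inter> K k))" for k using W_neighbourhood[OF C N[of k]] by blast
  moreover have "\<not> W k (N k ` (\<gamma> \<inter> K k)) \<subseteq> G" for k
    using neg fin[of k] calculation[of k] by metis
  ultimately have "\<exists>\<eta>. \<eta> \<in> W k (N k ` (\<gamma> \<inter> K k)) \<and> \<eta> \<notin> G" for k by blast
  then obtain g where g: "\<And>k. g k \<in> W k (N k ` (\<gamma> \<inter> K k))" "\<And>k. g k \<notin> G" by metis
  \<comment> \<open>Keeping every point and adding the empty configuration reduces the superposition
    result to convergence of \<open>g\<close> itself.\<close>
  have "limitin (vague X) (\<lambda>k. {y \<in> g k. (\<lambda>_. True) (tau \<gamma> k (N k) y)} \<union> {}) ({x \<in> \<gamma>. (\<lambda>_. True) x} \<union> {}) sequentially"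
    by (rule thinning_superposition_limit[OF C N g(1)]) (auto simp: Conf_def)
  then have "eventually (\<lambda>k. g k \<in> G) sequentially"
    using G \<gamma> unfolding limitin_def by simp
  then show False using g(2) by auto
qed

end

section \<open>Counting maps and the Borel structure\<close>

context lc_base
begin

text \<open>Relatively compact Borel sets, phrased through the exhaustion so that Borel subsets
  inherit the property at once; \<open>rc_iff\<close> gives the formulation that occurs in
  \<open>is_poisson\<close>.\<close>

definition rc :: "'a set \<Rightarrow> bool" where
  "rc B \<longleftrightarrow> B \<in> sets (borel_of X) \<and> (\<exists>k. B \<subseteq> K k)"

lemma rc_subset: "rc B \<Longrightarrow> A \<subseteq> B \<Longrightarrow> A \<in> sets (borel_of X) \<Longrightarrow> rc A"
  unfolding rc_def by blast

lemma rc_sets: "rc B \<Longrightarrow> B \<in> sets (borel_of X)" by (simp add: rc_def)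

lemma rc_topspace: "rc B \<Longrightarrow> B \<subseteq> topspace X"
  unfolding rc_def using K_topspace by blast

lemma b_K: "b n \<subseteq> K (Suc n)"
proof -
  have "X closure_of b n \<subseteq> K (Suc n)" unfolding K_def by (rule UN_upper) simp
  then show ?thesis using b_closure by (rule order_trans[rotated])
qed

lemma rc_K: "rc (K k)"
  unfolding rc_def using closed_K closedin_in_borel_of by blast

lemma rc_b: "rc (b n)"
  unfolding rc_def using open_b openin_in_borel_of b_K by blast

lemma rc_iff: "rc B \<longleftrightarrow> B \<in> sets (borel_of X) \<and> compactin X (X closure_of B)"
proof (intro iffI conjI)
  assume rc: "rc B"
  then obtain k where k: "B \<subseteq> K k" by (auto simp: rc_def)
  then have "X closure_of B \<subseteq> K k" using closed_K by (rule closure_of_minimal)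
  then show "compactin X (X closure_of B)" using closed_compactin[OF compact_K] by auto
next
  assume B: "B \<in> sets (borel_of X) \<and> compactin X (X closure_of B)"
  then have "B \<subseteq> topspace X" using sets.sets_into_space[of B "borel_of X"] by simp
  moreover obtain k where "X closure_of B \<subseteq> K k" using B compact_subset_K by blast
  ultimately show "rc B" unfolding rc_def using B closure_of_subset[of B X] by blast
qed (simp add: rc_def)

lemma rc_singleton: "x \<in> topspace X \<Longrightarrow> rc {x}"
  unfolding rc_def using in_K closedin_in_borel_of[OF finite_closedin[of "{x}"]] by simp

lemma finite_Conf_rc: "\<gamma> \<in> Conf X \<Longrightarrow> rc B \<Longrightarrow> finite (\<gamma> \<inter> B)"
  unfolding rc_def Conf_iff by (auto intro: finite_subset[of "\<gamma> \<inter> B" "\<gamma> \<inter> K _"])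

text \<open>Lower semicontinuity of counts on open sets: a bump function that is 1 on the points of
  \<open>\<gamma>\<close> in \<open>U\<close> and 0 off \<open>U\<close> bounds nearby counts from
  below. Containment in \<open>K k\<close> keeps \<open>card\<close> from taking its default value 0
  on infinite sets.\<close>

lemma openin_card_less:
  assumes U: "openin X U" "U \<subseteq> K k"
  shows "openin (vague X) {\<gamma> \<in> Conf X. c < card (\<gamma> \<inter> U)}"
proof (subst openin_subopen, intro ballI)
  fix \<gamma> assume g: "\<gamma> \<in> {\<gamma> \<in> Conf X. c < card (\<gamma> \<inter> U)}"
  have fin: "finite (\<gamma> \<inter> U)" and sub: "\<gamma> \<subseteq> topspace X"
    using g U by (auto simp: Conf_iff intro: finite_subset[of "\<gamma> \<inter> U" "\<gamma> \<inter> K k"])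
  have "compactin X (\<gamma> \<inter> U)" using fin sub by (intro finite_imp_compactin) auto
  then obtain \<phi> where \<phi>: "\<phi> \<in> Cc X" "\<And>x. x \<in> topspace X \<Longrightarrow> 0 \<le> \<phi> x \<and> \<phi> x \<le> 1"
    "\<And>x. x \<in> \<gamma> \<inter> U \<Longrightarrow> \<phi> x = 1" "\<And>x. x \<in> topspace X \<Longrightarrow> x \<notin> U \<Longrightarrow> \<phi> x = 0"
    using U(1) by (rule bump) auto
  define T where "T = {\<eta> \<in> Conf X. conf_sum \<phi> \<eta> \<in> {real c<..}}"
  have "openin (vague X) T" unfolding T_def by (rule openin_vague_conf_sum[OF \<phi>(1)]) simp
  moreover have "\<gamma> \<in> T"
  proof -
    have "conf_sum \<phi> \<gamma> = real (card (\<gamma> \<inter> U))"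
      using \<phi> sub by (intro conf_sum_indicator) auto
    then show ?thesis using g by (simp add: T_def)
  qed
  moreover have "T \<subseteq> {\<gamma> \<in> Conf X. c < card (\<gamma> \<inter> U)}"
  proof
    fix \<eta> assume e: "\<eta> \<in> T"
    then have eC: "\<eta> \<in> Conf X" "\<eta> \<subseteq> topspace X" by (auto simp: T_def Conf_def)
    have fin: "finite (\<eta> \<inter> U)"
      using eC U by (auto simp: Conf_iff intro: finite_subset[of "\<eta> \<inter> U" "\<eta> \<inter> K k"])
    have "conf_sum \<phi> \<eta> = (\<Sum>x\<in>\<eta> \<inter> U. \<phi> x)"
      using \<phi>(4) eC fin by (intro conf_sum_eq) auto
    also have "\<dots> \<le> (\<Sum>x\<in>\<eta> \<inter> U. 1)"
      using \<phi>(2) eC by (intro sum_mono) auto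
    finally have "conf_sum \<phi> \<eta> \<le> real (card (\<eta> \<inter> U))" by simp
    then show "\<eta> \<in> {\<gamma> \<in> Conf X. c < card (\<gamma> \<inter> U)}" using e eC by (simp add: T_def)
  qed
  ultimately show "\<exists>T. openin (vague X) T \<and> \<gamma> \<in> T \<and> T \<subseteq> {\<gamma> \<in> Conf X. c < card (\<gamma> \<inter> U)}"
    by (intro exI[of _ T] conjI)
qed

text \<open>Intersecting with a relatively compact open \<open>U\<close> keeps all counts finite, so that complements
  are available in the Dynkin argument.\<close>

lemma count_measurable:
  assumes B: "rc B"
  shows "(\<lambda>\<gamma>. card (\<gamma> \<inter> B)) \<in> measurable (borel_of (vague X)) (count_space UNIV)"
proof -
  obtain k where k: "B \<subseteq> K k" using B by (auto simp: rc_def)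
  obtain U L where UL: "openin X U" "compactin X L" "K k \<subseteq> U" "U \<subseteq> L"
    by (rule compact_neighbourhood[OF compact_K])
  obtain l where l: "L \<subseteq> K l" using compact_subset_K[OF UL(2)] by blast
  \<comment> \<open>Counting is done with an \<open>ennreal\<close>-valued measure, so that disjoint
    unions are covered by countable additivity; the return to \<open>card\<close> happens only at
    the end, using \<open>U \<inter> B = B\<close>.\<close>
  define f where "f A \<gamma> = emeasure (count_space UNIV) (\<gamma> \<inter> (U \<inter> A))" for A and \<gamma> :: "'a set"
  let ?V = "borel_of (vague X)"
  have fin: "finite (\<gamma> \<inter> (U \<inter> A))" if "\<gamma> \<in> Conf X" for \<gamma> A
  proof -
    have "\<gamma> \<inter> (U \<inter> A) \<subseteq> \<gamma> \<inter> K l" using l UL(4) by blast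
    moreover have "finite (\<gamma> \<inter> K l)" using that by (simp add: Conf_iff)
    ultimately show ?thesis by (rule finite_subset)
  qed
  have f_card: "f A \<gamma> = of_nat (card (\<gamma> \<inter> (U \<inter> A)))" if "\<gamma> \<in> Conf X" for A \<gamma>
    unfolding f_def using fin[OF that] by (rule emeasure_count_space_finite[OF subset_UNIV])
  have cong: "g \<in> borel_measurable ?V"
    if "h \<in> borel_measurable ?V" "\<And>\<gamma>. \<gamma> \<in> Conf X \<Longrightarrow> g \<gamma> = h \<gamma>" for g h :: "'a set \<Rightarrow> ennreal"
    using that measurable_cong[of ?V g h borel] by simp
  have open_f: "f A \<in> borel_measurable ?V" if A: "openin X A" for A
  proof -
    have "(\<lambda>\<gamma>. card (\<gamma> \<inter> (U \<inter> A))) \<in> measurable ?V (count_space UNIV)"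
      unfolding measurable_count_space_eq2_countable
    proof (safe)
      fix c
      have *: "{\<gamma> \<in> Conf X. c < card (\<gamma> \<inter> (U \<inter> A))} \<in> sets ?V" for c
        using UL(1,4) l A by (intro openin_in_borel_of openin_card_less[of _ l]) auto
      have **: "{\<gamma> \<in> Conf X. c \<le> card (\<gamma> \<inter> (U \<inter> A))} \<in> sets ?V"
      proof (cases c)
        case 0
        then show ?thesis using sets.top[of ?V] by simp
      next
        case (Suc d)
        then show ?thesis using *[of d] by (simp add: Suc_le_eq)
      qed
      have "(\<lambda>\<gamma>. card (\<gamma> \<inter> (U \<inter> A))) -` {c} \<inter> space ?V =
          {\<gamma> \<in> Conf X. c \<le> card (\<gamma> \<inter> (U \<inter> A))} - {\<gamma> \<in> Conf X. c < card (\<gamma> \<inter> (U \<inter> A))}"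
        by auto
      then show "(\<lambda>\<gamma>. card (\<gamma> \<inter> (U \<inter> A))) -` {c} \<inter> space ?V \<in> sets ?V"
        using sets.Diff[OF ** *] by simp
    qed auto
    then have "(\<lambda>\<gamma>. of_nat (card (\<gamma> \<inter> (U \<inter> A))) :: ennreal) \<in> borel_measurable ?V"
      by (rule measurable_compose) simp
    then show ?thesis by (rule cong) (simp add: f_card)
  qed
  have "Int_stable {U. openin X U}" by (auto simp: Int_stable_def)
  moreover have "{U. openin X U} \<subseteq> Pow (topspace X)" using openin_subset by fastforce
  moreover have "B \<in> sigma_sets (topspace X) {U. openin X U}" using B by (simp add: rc_def sets_borel_of)
  ultimately have "f B \<in> borel_measurable ?V"
  proof (induction rule: sigma_sets_induct_disjoint)
    case (basic A)
    then show ?case using open_f by simp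
  next
    case empty
    then show ?case by (simp add: f_def)
  next
    case (compl A)
    have "f (topspace X - A) \<gamma> = f (topspace X) \<gamma> - f A \<gamma>" if "\<gamma> \<in> Conf X" for \<gamma>
    proof -
      have sub: "\<gamma> \<inter> (U \<inter> A) \<subseteq> \<gamma> \<inter> (U \<inter> topspace X)" using that by (auto simp: Conf_def)
      have "\<gamma> \<inter> (U \<inter> (topspace X - A)) = \<gamma> \<inter> (U \<inter> topspace X) - \<gamma> \<inter> (U \<inter> A)" by auto
      moreover have "emeasure (count_space UNIV) (\<gamma> \<inter> (U \<inter> topspace X) - \<gamma> \<inter> (U \<inter> A)) = f (topspace X) \<gamma> - f A \<gamma>"
        unfolding f_def using sub f_card[OF that, of A] unfolding f_def
        by (intro emeasure_Diff) auto
      ultimately show ?thesis by (simp add: f_def)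
    qed
    moreover have "(\<lambda>\<gamma>. f (topspace X) \<gamma> - f A \<gamma>) \<in> borel_measurable ?V"
      using open_f[of "topspace X"] compl by measurable
    ultimately show ?case by (rule cong[rotated])
  next
    case (union A)
    have "f (\<Union>i. A i) \<gamma> = (\<Sum>i. f (A i) \<gamma>)" for \<gamma>
    proof -
      have "(\<Sum>i. f (A i) \<gamma>) = emeasure (count_space UNIV) (\<Union>i. \<gamma> \<inter> (U \<inter> A i))"
        unfolding f_def using union(1) by (intro suminf_emeasure) (auto simp: disjoint_family_on_def)
      also have "(\<Union>i. \<gamma> \<inter> (U \<inter> A i)) = \<gamma> \<inter> (U \<inter> (\<Union>i. A i))" by auto
      finally show ?thesis by (simp add: f_def)
    qed
    moreover have "(\<lambda>\<gamma>. \<Sum>i. f (A i) \<gamma>) \<in> borel_measurable ?V"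
      using union by measurable
    ultimately show ?case by (rule cong[rotated])
  qed
  moreover have "f B \<gamma> = of_nat (card (\<gamma> \<inter> B))" if "\<gamma> \<in> Conf X" for \<gamma>
  proof -
    have "U \<inter> B = B" using k UL(3) by blast
    then show ?thesis using f_card[OF that, of B] by simp
  qed
  ultimately have fB: "(\<lambda>\<gamma>. of_nat (card (\<gamma> \<inter> B)) :: ennreal) \<in> borel_measurable ?V"
    using cong[of "f B" "\<lambda>\<gamma>. of_nat (card (\<gamma> \<inter> B))"] by simp
  show ?thesis
    unfolding measurable_count_space_eq2_countable
  proof safe
    fix c
    have "(\<lambda>\<gamma>. of_nat (card (\<gamma> \<inter> B)) :: ennreal) -` {of_nat c} \<inter> space ?V \<in> sets ?V"
      using fB by (rule measurable_sets) simp
    also have "(\<lambda>\<gamma>. of_nat (card (\<gamma> \<inter> B)) :: ennreal) -` {of_nat c} = (\<lambda>\<gamma>. card (\<gamma> \<inter> B)) -` {c}"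
      by auto
    finally show "(\<lambda>\<gamma>. card (\<gamma> \<inter> B)) -` {c} \<inter> space ?V \<in> sets ?V" .
  qed auto
qed

text \<open>By \<open>W_base\<close> every open set is a union of sets \<open>W k I\<close> with
  finite \<open>I\<close>. There are countably many such pairs, and each \<open>W k I\<close> is a
  finite combination of count events.\<close>

lemma measurable_into_Conf:
  assumes f: "\<And>\<omega>. \<omega> \<in> space M \<Longrightarrow> f \<omega> \<in> Conf X"
    and meas: "\<And>B k. rc B \<Longrightarrow> {\<omega> \<in> space M. card (f \<omega> \<inter> B) = k} \<in> sets M"
  shows "f \<in> measurable M (borel_of (vague X))"
  unfolding borel_of_def
proof (rule measurable_measure_of)
  show "{U. openin (vague X) U} \<subseteq> Pow (topspace (vague X))" using openin_subset by fastforce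
  show "f \<in> space M \<rightarrow> topspace (vague X)" using f by auto
  fix G assume "G \<in> {U. openin (vague X) U}"
  then have G: "openin (vague X) G" by simp
  define J where "J = {(k, I). finite I \<and> W k I \<subseteq> G}"
  have "J \<subseteq> UNIV \<times> Collect finite" by (auto simp: J_def)
  then have cJ: "countable J"
    by (rule countable_subset) (intro countable_SIGMA countableI_type countable_Collect_finite)
  have W: "f -` W k I \<inter> space M \<in> sets M" if I: "finite I" for k I
  proof -
    have rc: "rc (K k - (\<Union>n\<in>I. b n))"
      using I rc_sets[OF rc_K] rc_sets[OF rc_b] by (intro rc_subset[OF rc_K]) auto
    have "f -` W k I \<inter> space M = {\<omega> \<in> space M. card (f \<omega> \<inter> (K k - (\<Union>n\<in>I. b n))) = 0}
        \<inter> {\<omega> \<in> space M. \<forall>n\<in>I. card (f \<omega> \<inter> b n) = 1}"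
    proof -
      have "f \<omega> \<in> W k I \<longleftrightarrow> card (f \<omega> \<inter> (K k - (\<Union>n\<in>I. b n))) = 0 \<and> (\<forall>n\<in>I. card (f \<omega> \<inter> b n) = 1)"
        if "\<omega> \<in> space M" for \<omega>
        using f[OF that] finite_Conf_rc[OF f[OF that] rc] by (simp add: W_def)
      then show ?thesis by blast
    qed
    moreover have "{\<omega> \<in> space M. \<forall>n\<in>I. card (f \<omega> \<inter> b n) = 1} \<in> sets M"
      using I meas[OF rc_b] by (intro sets.sets_Collect_finite_All) auto
    ultimately show ?thesis using meas[OF rc] by auto
  qed
  have "f -` G \<inter> space M = (\<Union>(k, I)\<in>J. f -` W k I \<inter> space M)"
  proof
    show "f -` G \<inter> space M \<subseteq> (\<Union>(k, I)\<in>J. f -` W k I \<inter> space M)"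
    proof
      fix \<omega> assume w: "\<omega> \<in> f -` G \<inter> space M"
      then obtain k I where "finite I" "f \<omega> \<in> W k I" "W k I \<subseteq> G" using W_base[OF G] by blast
      then show "\<omega> \<in> (\<Union>(k, I)\<in>J. f -` W k I \<inter> space M)"
        using w by (intro UN_I[of "(k, I)"]) (auto simp: J_def)
    qed
  qed (auto simp: J_def)
  moreover have "(\<Union>p\<in>J. (case p of (k, I) \<Rightarrow> f -` W k I \<inter> space M)) \<in> sets M"
    using cJ W by (intro sets.countable_UN') (auto simp: J_def)
  ultimately show "f -` G \<inter> space M \<in> sets M" by simp
qed

end

section \<open>Uniqueness of the Poisson measure\<close>

context lc_base
begin

lemma count_sets:
  assumes "rc B"
  shows "{\<gamma> \<in> Conf X. card (\<gamma> \<inter> B) = k} \<in> sets (borel_of (vague X))"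
proof -
  have "{\<gamma> \<in> Conf X. card (\<gamma> \<inter> B) = k} = (\<lambda>\<gamma>. card (\<gamma> \<inter> B)) -` {k} \<inter> space (borel_of (vague X))"
    by auto
  then show ?thesis using measurable_sets[OF count_measurable[OF assms]] by simp
qed

definition cyl :: "'a set set \<Rightarrow> ('a set \<Rightarrow> nat) \<Rightarrow> 'a set set" where
  "cyl \<A> k = {\<gamma> \<in> Conf X. \<forall>B\<in>\<A>. card (\<gamma> \<inter> B) = k B}"

lemma cyl_sets:
  assumes "finite \<A>" "\<And>B. B \<in> \<A> \<Longrightarrow> rc B"
  shows "cyl \<A> k \<in> sets (borel_of (vague X))"
proof -
  have "{\<gamma> \<in> space (borel_of (vague X)). \<forall>B\<in>\<A>. card (\<gamma> \<inter> B) = k B} \<in> sets (borel_of (vague X))"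
    using assms count_sets by (intro sets.sets_Collect_finite_All) auto
  then show ?thesis by (simp add: cyl_def)
qed

text \<open>The empty set is adjoined for the sake of a pi-system: two cylinders that prescribe
  different counts for the same set have empty intersection.\<close>

definition cyls :: "'a set set set" where
  "cyls = {{}} \<union> {cyl \<A> k | \<A> k. finite \<A> \<and> (\<forall>B\<in>\<A>. rc B)}"

lemma Int_stable_cyls: "Int_stable cyls"
proof -
  have "cyl \<A> k \<inter> cyl \<A>' k' \<in> cyls"
    if A: "finite \<A>" "\<forall>B\<in>\<A>. rc B" "finite \<A>'" "\<forall>B\<in>\<A>'. rc B" for \<A> k \<A>' k'
  proof (cases "\<forall>B\<in>\<A> \<inter> \<A>'. k B = k' B")
    case True
    then have "cyl \<A> k \<inter> cyl \<A>' k' = cyl (\<A> \<union> \<A>') (\<lambda>B. if B \<in> \<A> then k B else k' B)"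
      unfolding cyl_def by auto
    then show ?thesis unfolding cyls_def using A by blast
  next
    case False
    then have "cyl \<A> k \<inter> cyl \<A>' k' = {}" unfolding cyl_def by force
    then show ?thesis unfolding cyls_def by simp
  qed
  note Int = this
  show ?thesis
    unfolding Int_stable_def
  proof (intro ballI)
    fix C D assume CD: "C \<in> cyls" "D \<in> cyls"
    show "C \<inter> D \<in> cyls"
    proof (cases "C = {} \<or> D = {}")
      case True
      then have "C \<inter> D = {}" by blast
      then show ?thesis by (simp add: cyls_def)
    next
      case False
      then obtain \<A> k \<A>' k' where "C = cyl \<A> k" "finite \<A>" "\<forall>B\<in>\<A>. rc B"
        "D = cyl \<A>' k'" "finite \<A>'" "\<forall>B\<in>\<A>'. rc B"
        using CD unfolding cyls_def by blast
      then show ?thesis using Int by simp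
    qed
  qed
qed

text \<open>That Borel sets belong to the cylinder sigma-algebra amounts to measurability of the
  identity map, which \<open>measurable_into_Conf\<close> reduces to counts.\<close>

lemma sets_vague: "sets (borel_of (vague X)) = sigma_sets (Conf X) cyls"
proof
  have sub: "cyls \<subseteq> Pow (Conf X)" by (auto simp: cyls_def cyl_def)
  show "sigma_sets (Conf X) cyls \<subseteq> sets (borel_of (vague X))"
    using sets.sigma_sets_subset[of cyls "borel_of (vague X)"] cyl_sets by (auto simp: cyls_def)
  let ?S = "sigma (Conf X) cyls"
  have S: "space ?S = Conf X" "sets ?S = sigma_sets (Conf X) cyls" using sub by (auto simp: space_measure_of)
  have "(\<lambda>x. x) \<in> measurable ?S (borel_of (vague X))"
  proof (rule measurable_into_Conf)
    fix B k assume "rc B"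
    then have "cyl {B} (\<lambda>_. k) \<in> cyls" unfolding cyls_def by blast
    then show "{\<omega> \<in> space ?S. card (\<omega> \<inter> B) = k} \<in> sets ?S"
      unfolding S by (intro sigma_sets.Basic) (simp add: cyl_def)
  qed (simp add: S)
  then show "sets (borel_of (vague X)) \<subseteq> sigma_sets (Conf X) cyls"
    using S sets.sets_into_space[of _ "borel_of (vague X)"] unfolding measurable_def by (auto simp: Int_absorb2)
qed

text \<open>Every cylinder over arbitrary sets splits into countably many cylinders over the atoms
  of the finite algebra they generate, and atoms are disjoint.\<close>

lemma measure_eqI_disjoint_cyls:
  assumes \<mu>: "prob_space \<mu>" "sets \<mu> = sets (borel_of (vague X))"
    and \<nu>: "prob_space \<nu>" "sets \<nu> = sets (borel_of (vague X))"
    and eq: "\<And>\<A> k. finite \<A> \<Longrightarrow> disjoint \<A> \<Longrightarrow> (\<And>B. B \<in> \<A> \<Longrightarrow> rc B) \<Longrightarrow>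
      measure \<mu> (cyl \<A> k) = measure \<nu> (cyl \<A> k)"
  shows "\<mu> = \<nu>"
proof (rule measure_eqI_generator_eq[OF Int_stable_cyls, of "Conf X"])
  interpret \<mu>: prob_space \<mu> by fact
  interpret \<nu>: prob_space \<nu> by fact
  show "cyls \<subseteq> Pow (Conf X)" by (auto simp: cyls_def cyl_def)
  show "sets \<mu> = sigma_sets (Conf X) cyls" "sets \<nu> = sigma_sets (Conf X) cyls"
    using \<mu> \<nu> sets_vague by auto
  have "cyl {} (\<lambda>_. 0) \<in> cyls" unfolding cyls_def by blast
  then show "range (\<lambda>_::nat. Conf X) \<subseteq> cyls" by (auto simp: cyl_def)
  show "(\<Union>i::nat. Conf X) = Conf X" by simp
  show "emeasure \<mu> (Conf X) \<noteq> \<infinity>" by simp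
  fix C assume "C \<in> cyls"
  then consider "C = {}" | \<B> k where "C = cyl \<B> k" "finite \<B>" "\<forall>B\<in>\<B>. rc B"
    by (auto simp: cyls_def)
  then show "emeasure \<mu> C = emeasure \<nu> C"
  proof cases
    case 2
    define atm where "atm I = {x \<in> topspace X. \<forall>B\<in>\<B>. x \<in> B \<longleftrightarrow> B \<in> I}" for I
    \<comment> \<open>The atom of the empty index set is the complement of all members of
      \<open>\<B>\<close>. It is left out because it need not be relatively compact.\<close>
    define \<A> where "\<A> = atm ` (Pow \<B> - {{}})"
    have fin: "finite \<A>" using 2(2) by (simp add: \<A>_def)
    have at_disj: "atm I \<inter> atm J = {}" if "I \<subseteq> \<B>" "J \<subseteq> \<B>" "I \<noteq> J" for I J
      using that unfolding atm_def by blast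
    have disj: "A \<inter> A' = {}" if "A \<in> \<A>" "A' \<in> \<A>" "A \<noteq> A'" for A A'
      using that at_disj unfolding \<A>_def by blast
    have rc: "rc A" if A: "A \<in> \<A>" for A
    proof -
      obtain I where I: "I \<subseteq> \<B>" "I \<noteq> {}" "A = atm I" using A by (auto simp: \<A>_def)
      then obtain B where B: "B \<in> I" "B \<in> \<B>" by blast
      have "{x \<in> space (borel_of X). \<forall>B\<in>\<B>. x \<in> B \<longleftrightarrow> B \<in> I} \<in> sets (borel_of X)"
      proof (intro sets.sets_Collect_finite_All 2(2))
        fix B assume B: "B \<in> \<B>"
        have "{x \<in> space (borel_of X). x \<in> B} \<in> sets (borel_of X)"
        proof -
          have "{x \<in> space (borel_of X). x \<in> B} = B" using B 2(3) rc_topspace by auto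
          then show ?thesis using B 2(3) rc_sets by simp
        qed
        then show "{x \<in> space (borel_of X). (x \<in> B) = (B \<in> I)} \<in> sets (borel_of X)"
          by (cases "B \<in> I") (auto simp del: space_borel_of intro: sets.sets_Collect_neg)
      qed
      then have "A \<in> sets (borel_of X)" by (simp add: I atm_def)
      moreover have "A \<subseteq> B" using I B by (auto simp: atm_def)
      ultimately show ?thesis using rc_subset 2(3) B by blast
    qed
    have cardB: "card (\<gamma> \<inter> B) = (\<Sum>A\<in>{A\<in>\<A>. A \<subseteq> B}. card (\<gamma> \<inter> A))"
      if g: "\<gamma> \<in> Conf X" and B: "B \<in> \<B>" for \<gamma> B
    proof -
      have "B = \<Union>{A\<in>\<A>. A \<subseteq> B}"
      proof
        show "B \<subseteq> \<Union>{A\<in>\<A>. A \<subseteq> B}"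
        proof
          fix x assume x: "x \<in> B"
          define I where "I = {B\<in>\<B>. x \<in> B}"
          have "x \<in> topspace X" using x B 2(3) rc_topspace by blast
          then have "x \<in> atm I" by (simp add: atm_def I_def)
          moreover have "I \<in> Pow \<B> - {{}}" using x B by (auto simp: I_def)
          then have "atm I \<in> \<A>" unfolding \<A>_def by (rule imageI)
          moreover have "atm I \<subseteq> B" using x B by (auto simp: I_def atm_def)
          ultimately show "x \<in> \<Union>{A\<in>\<A>. A \<subseteq> B}" by blast
        qed
      qed auto
      then have "\<gamma> \<inter> B = (\<Union>A\<in>{A\<in>\<A>. A \<subseteq> B}. \<gamma> \<inter> A)" by blast
      also have "card \<dots> = (\<Sum>A\<in>{A\<in>\<A>. A \<subseteq> B}. card (\<gamma> \<inter> A))"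
        using fin disj finite_Conf_rc[OF g rc] by (intro card_UN_disjoint) auto
      finally show ?thesis .
    qed
    \<comment> \<open>All ways of distributing the prescribed counts over the atoms. Functions are
      extensional, so that different members of \<open>F\<close> differ on some atom and their
      cylinders are disjoint.\<close>
    define F where "F = {f \<in> \<A> \<rightarrow>\<^sub>E UNIV. \<forall>B\<in>\<B>. (\<Sum>A\<in>{A\<in>\<A>. A \<subseteq> B}. f A) = k B}"
    have "countable (\<A> \<rightarrow>\<^sub>E (UNIV :: nat set))" using fin by (intro countable_PiE) auto
    then have cF: "countable F" by (rule countable_subset[rotated]) (auto simp: F_def)
    have C: "C = (\<Union>f\<in>F. cyl \<A> f)"
    proof
      show "C \<subseteq> (\<Union>f\<in>F. cyl \<A> f)"
      proof
        fix \<gamma> assume g: "\<gamma> \<in> C"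
        define f where "f = restrict (\<lambda>A. card (\<gamma> \<inter> A)) \<A>"
        have "f \<in> F" using g cardB by (auto simp: F_def f_def 2 cyl_def)
        moreover have "\<gamma> \<in> cyl \<A> f" using g by (simp add: f_def cyl_def 2)
        ultimately show "\<gamma> \<in> (\<Union>f\<in>F. cyl \<A> f)" by blast
      qed
      show "(\<Union>f\<in>F. cyl \<A> f) \<subseteq> C" using cardB by (auto simp: F_def 2 cyl_def)
    qed
    have dF: "disjoint_family_on (cyl \<A>) F"
    proof -
      have "f = g" if fg: "f \<in> F" "g \<in> F" "\<gamma> \<in> cyl \<A> f" "\<gamma> \<in> cyl \<A> g" for f g \<gamma>
      proof (rule PiE_ext)
        show "f \<in> \<A> \<rightarrow>\<^sub>E UNIV" "g \<in> \<A> \<rightarrow>\<^sub>E UNIV" using fg by (auto simp: F_def)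
        show "f A = g A" if "A \<in> \<A>" for A using that fg(3,4) by (auto simp: cyl_def)
      qed
      then show ?thesis by (auto simp: disjoint_family_on_def)
    qed
    have "disjoint \<A>" using disj by (auto simp: disjoint_def)
    then have "emeasure \<mu> (cyl \<A> f) = emeasure \<nu> (cyl \<A> f)" for f
      using eq[OF fin _ rc, of f] by (simp add: \<mu>.emeasure_eq_measure \<nu>.emeasure_eq_measure)
    then show ?thesis
      unfolding C using cF dF cyl_sets[OF fin rc] \<mu>(2) \<nu>(2)
      by (simp add: emeasure_UN_countable)
  qed simp
qed

lemma is_poisson_cyl:
  assumes p: "is_poisson X m z \<mu>" and m: "sets m = sets (borel_of X)"
    and A: "finite \<A>" "disjoint \<A>" "\<And>B. B \<in> \<A> \<Longrightarrow> rc B"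
  shows "measure \<mu> (cyl \<A> k) = (\<Prod>B\<in>\<A>. (z * measure m B) ^ k B / fact (k B) * exp (- (z * measure m B)))"
proof -
  obtain h where h: "bij_betw h {0..<card \<A>} \<A>" using ex_bij_betw_nat_finite[OF A(1)] by blast
  let ?n = "card \<A>"
  have hA: "h i \<in> \<A>" if "i < ?n" for i using h that by (auto simp: bij_betw_def)
  have im: "\<A> = h ` {..<?n}" using h by (auto simp: bij_betw_def lessThan_atLeast0)
  have "measure \<mu> {\<gamma>\<in>Conf X. \<forall>i<?n. card (\<gamma> \<inter> h i) = k (h i)} =
          (\<Prod>i<?n. (z * measure m (h i)) ^ k (h i) / fact (k (h i)) * exp (- (z * measure m (h i))))"
  proof -
    have "\<forall>i<?n. h i \<in> sets m \<and> compactin X (X closure_of h i)" using A(3)[OF hA] rc_iff m by simp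
    moreover have "\<forall>i<?n. \<forall>j<?n. i \<noteq> j \<longrightarrow> h i \<inter> h j = {}"
    proof (intro allI impI)
      fix i j assume ij: "i < ?n" "j < ?n" "i \<noteq> j"
      then have "h i \<noteq> h j" using h by (auto simp: bij_betw_def inj_on_def)
      then show "h i \<inter> h j = {}" using A(2) hA ij by (auto simp: disjoint_def)
    qed
    ultimately show ?thesis
      by (rule p[unfolded is_poisson_def, THEN conjunct2, THEN conjunct2,
            THEN spec, THEN spec, THEN spec, THEN mp, THEN mp])
  qed
  also have "{\<gamma>\<in>Conf X. \<forall>i<?n. card (\<gamma> \<inter> h i) = k (h i)} = cyl \<A> k"
    unfolding cyl_def by (subst (2) im) auto
  also have "(\<Prod>i<?n. (z * measure m (h i)) ^ k (h i) / fact (k (h i)) * exp (- (z * measure m (h i)))) =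
      (\<Prod>B\<in>\<A>. (z * measure m B) ^ k B / fact (k B) * exp (- (z * measure m B)))"
    using h by (intro prod.reindex_bij_betw) (simp add: lessThan_atLeast0)
  finally show ?thesis .
qed

lemma is_poisson_unique:
  assumes "is_poisson X m z \<mu>" "is_poisson X m z \<nu>" "sets m = sets (borel_of X)"
  shows "\<mu> = \<nu>"
proof (rule measure_eqI_disjoint_cyls)
  fix \<A> k assume "finite \<A>" "disjoint \<A>" "\<And>B. B \<in> \<A> \<Longrightarrow> rc B"
  note * = is_poisson_cyl[OF _ assms(3) this]
  show "measure \<mu> (cyl \<A> k) = measure \<nu> (cyl \<A> k)"
    by (rule trans[OF *[OF assms(1)] *[OF assms(2), symmetric]])
qed (use assms(1,2) in \<open>simp_all add: is_poisson_def\<close>)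

end

section \<open>Probability generating functions\<close>

text \<open>The sum is known to vanish only for positive arguments, so coefficients are read off
  from a one-sided limit: once the lower ones vanish, division by \<open>u ^ n\<close> leaves a
  power series with constant term \<open>d n\<close>.\<close>

lemma powser_zero_coeffs:
  fixes d :: "nat \<Rightarrow> real"
  assumes sm: "\<And>u. norm u < 1 \<Longrightarrow> summable (\<lambda>k. d k * u ^ k)"
    and zero: "\<And>u. 0 < u \<Longrightarrow> u < 1 \<Longrightarrow> (\<Sum>k. d k * u ^ k) = 0"
  shows "d n = 0"
proof (induction n rule: less_induct)
  case (less n)
  have shift: "(\<lambda>k. d (k + n) * u ^ k) sums (if u = 0 then d n else (\<Sum>k. d k * u ^ k) / u ^ n)"
    if u: "norm u < 1" for u
  proof (cases "u = 0")
    case True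
    then show ?thesis using powser_sums_zero[of "\<lambda>k. d (k + n)"] by simp
  next
    case False
    have "(\<lambda>k. d (k + n) * u ^ (k + n)) sums ((\<Sum>k. d k * u ^ k) - (\<Sum>k<n. d k * u ^ k))"
      using sums_split_initial_segment[OF summable_sums[OF sm[OF u]], of n] .
    then have "(\<lambda>k. d (k + n) * u ^ (k + n) / u ^ n) sums ((\<Sum>k. d k * u ^ k) / u ^ n)"
      using less.IH by (intro sums_divide) simp
    then show ?thesis using False by (simp add: power_add)
  qed
  have "((\<lambda>u. if u = 0 then d n else (\<Sum>k. d k * u ^ k) / u ^ n) \<longlongrightarrow> d (0 + n)) (at 0)"
    using shift by (intro powser_limit_0[where s = 1]) auto
  then have "((\<lambda>u. if u = 0 then d n else (\<Sum>k. d k * u ^ k) / u ^ n) \<longlongrightarrow> d n) (at_right 0)"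
    by (simp add: filterlim_at_split)
  moreover have "eventually (\<lambda>u. (if u = 0 then d n else (\<Sum>k. d k * u ^ k) / u ^ n) = 0) (at_right 0)"
    unfolding eventually_at_right_field using zero by (intro exI[of _ 1]) auto
  then have "((\<lambda>u. if u = 0 then d n else (\<Sum>k. d k * u ^ k) / u ^ n) \<longlongrightarrow> 0) (at_right 0)"
    by (rule tendsto_eventually)
  ultimately show "d n = 0"
    using tendsto_unique[OF trivial_limit_at_right_real] by blast
qed

lemma sums_poisson_pgf:
  fixes a u :: real
  shows "(\<lambda>k. a ^ k / fact k * exp (- a) * u ^ k) sums exp (- (a * (1 - u)))"
proof -
  have "(\<lambda>k. exp (- a) * ((a * u) ^ k /\<^sub>R fact k)) sums (exp (- a) * exp (a * u))"
    by (intro sums_mult exp_converges)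
  moreover have "exp (- a) * exp (a * u) = exp (- (a * (1 - u)))"
    by (simp add: exp_add[symmetric] algebra_simps)
  ultimately show ?thesis by (simp add: power_mult_distrib field_simps)
qed

context prob_space
begin

text \<open>The weight \<open>H\<close> will carry the factors of the other counts while one of them
  is expanded. The geometric series in \<open>\<bar>u\<bar>\<close> justifies exchanging sum and
  integral.\<close>

lemma sums_pgf:
  fixes H :: "'a \<Rightarrow> real" and N :: "'a \<Rightarrow> nat"
  assumes [measurable]: "H \<in> borel_measurable M" "N \<in> measurable M (count_space UNIV)"
    and H: "\<And>\<omega>. \<omega> \<in> space M \<Longrightarrow> \<bar>H \<omega>\<bar> \<le> 1" and u: "\<bar>u\<bar> < 1"
  shows "(\<lambda>k. (\<integral>\<omega>. H \<omega> * of_bool (N \<omega> = k) \<partial>M) * u ^ k) sums (\<integral>\<omega>. H \<omega> * u ^ N \<omega> \<partial>M)"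
proof -
  define f where "f k \<omega> = H \<omega> * of_bool (N \<omega> = k) * u ^ k" for k \<omega>
  have f_le: "norm (f k \<omega>) \<le> \<bar>u\<bar> ^ k" if "\<omega> \<in> space M" for k \<omega>
    using H[OF that] by (auto simp: f_def abs_mult power_abs intro: mult_left_le_one_le)
  have [measurable]: "f k \<in> borel_measurable M" for k unfolding f_def by measurable
  have int: "integrable M (f k)" for k
    using f_le by (intro integrable_const_bound[of _ "\<bar>u\<bar> ^ k"]) auto
  have geo: "summable (\<lambda>k. \<bar>u\<bar> ^ k)" using u by (intro summable_geometric) simp
  have fs: "(\<lambda>k. f k \<omega>) sums (H \<omega> * u ^ N \<omega>)" for \<omega>
    using sums_single[of "N \<omega>" "\<lambda>k. H \<omega> * u ^ k"] unfolding f_def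
    by (rule sums_cong[THEN iffD1, rotated]) auto
  have "(\<lambda>k. integral\<^sup>L M (f k)) sums (\<integral>\<omega>. (\<Sum>k. f k \<omega>) \<partial>M)"
  proof (rule sums_integral[OF int])
    show "AE \<omega> in M. summable (\<lambda>k. norm (f k \<omega>))"
      using f_le by (intro AE_I2 summable_comparison_test'[OF geo]) auto
    have "norm (\<integral>\<omega>. norm (f k \<omega>) \<partial>M) \<le> \<bar>u\<bar> ^ k" for k
    proof -
      have "(\<integral>\<omega>. norm (f k \<omega>) \<partial>M) \<le> (\<integral>\<omega>. \<bar>u\<bar> ^ k \<partial>M)"
        using f_le int by (intro integral_mono) auto
      then show ?thesis by (simp add: prob_space)
    qed
    then show "summable (\<lambda>k. \<integral>\<omega>. norm (f k \<omega>) \<partial>M)"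
      by (intro summable_comparison_test'[OF geo])
  qed
  moreover have "(\<Sum>k. f k \<omega>) = H \<omega> * u ^ N \<omega>" for \<omega> using fs by (simp add: sums_iff)
  ultimately show ?thesis unfolding f_def by simp
qed

lemma pgf_coefficients:
  fixes H :: "'a \<Rightarrow> real" and N :: "'a \<Rightarrow> nat"
  assumes meas: "H \<in> borel_measurable M" "N \<in> measurable M (count_space UNIV)"
    and H: "\<And>\<omega>. \<omega> \<in> space M \<Longrightarrow> \<bar>H \<omega>\<bar> \<le> 1"
    and c: "\<And>u. \<bar>u\<bar> < 1 \<Longrightarrow> summable (\<lambda>k. c k * u ^ k)"
    and pgf: "\<And>u. 0 < u \<Longrightarrow> u < 1 \<Longrightarrow> (\<integral>\<omega>. H \<omega> * u ^ N \<omega> \<partial>M) = (\<Sum>k. c k * u ^ k)"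
  shows "(\<integral>\<omega>. H \<omega> * of_bool (N \<omega> = k) \<partial>M) = c k"
proof -
  let ?a = "\<lambda>k. (\<integral>\<omega>. H \<omega> * of_bool (N \<omega> = k) \<partial>M)"
  have a: "(\<lambda>k. ?a k * u ^ k) sums (\<integral>\<omega>. H \<omega> * u ^ N \<omega> \<partial>M)" if "\<bar>u\<bar> < 1" for u
    using sums_pgf[OF meas H that] .
  have d: "(\<lambda>k. (?a k - c k) * u ^ k) sums ((\<integral>\<omega>. H \<omega> * u ^ N \<omega> \<partial>M) - (\<Sum>k. c k * u ^ k))"
    if "\<bar>u\<bar> < 1" for u
    using sums_diff[OF a[OF that] summable_sums[OF c[OF that]]] by (simp add: left_diff_distrib)
  have "?a k - c k = 0"
  proof (rule powser_zero_coeffs[of "\<lambda>k. ?a k - c k"])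
    show "summable (\<lambda>k. (?a k - c k) * u ^ k)" if "norm u < 1" for u
      using d[of u] that by (auto simp: sums_iff)
    show "(\<Sum>k. (?a k - c k) * u ^ k) = 0" if "0 < u" "u < 1" for u
      using d[of u] pgf[OF that] that by (auto simp: sums_iff)
  qed
  then show ?thesis by simp
qed

text \<open>The exponents are peeled off one at a time: reading the identity as a power series in a single
  \<open>s i\<close> turns \<open>s i ^ N i\<close> into the event \<open>N i = k i\<close>.\<close>

lemma poisson_pgf_imp_joint:
  fixes N :: "'i \<Rightarrow> 'a \<Rightarrow> nat" and a :: "'i \<Rightarrow> real"
  assumes A: "finite A" and N[measurable]: "\<And>i. i \<in> A \<Longrightarrow> N i \<in> measurable M (count_space UNIV)"
    and pgf: "\<And>s. (\<And>i. 0 \<le> s i \<and> s i \<le> 1) \<Longrightarrow>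
      (\<integral>\<omega>. (\<Prod>i\<in>A. s i ^ N i \<omega>) \<partial>M) = (\<Prod>i\<in>A. exp (- (a i * (1 - s i))))"
  shows "prob {\<omega> \<in> space M. \<forall>i\<in>A. N i \<omega> = k i} = (\<Prod>i\<in>A. a i ^ k i / fact (k i) * exp (- a i))"
proof -
  let ?p = "\<lambda>i. a i ^ k i / fact (k i) * exp (- a i)"
  have step: "(\<integral>\<omega>. (\<Prod>i\<in>B. of_bool (N i \<omega> = k i)) * (\<Prod>i\<in>A - B. s i ^ N i \<omega>) \<partial>M) =
      (\<Prod>i\<in>B. ?p i) * (\<Prod>i\<in>A - B. exp (- (a i * (1 - s i))))"
    if B: "B \<subseteq> A" and s: "\<And>i. 0 \<le> s i \<and> s i \<le> 1" for B and s :: "'i \<Rightarrow> real"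
    using finite_subset[OF B A] B s
  proof (induction B arbitrary: s rule: finite_induct)
    case empty
    then show ?case using pgf by simp
  next
    case (insert r B)
    define H where "H \<omega> = (\<Prod>i\<in>B. of_bool (N i \<omega> = k i)) * (\<Prod>i\<in>A - insert r B. s i ^ N i \<omega>)" for \<omega>
    define C where "C = (\<Prod>i\<in>B. ?p i) * (\<Prod>i\<in>A - insert r B. exp (- (a i * (1 - s i))))"
    have r: "r \<in> A" "finite (A - insert r B)" "A - B = insert r (A - insert r B)" "r \<notin> A - insert r B"
      using insert A by auto
    have Nr: "N r \<in> measurable M (count_space UNIV)" using N r by blast
    have Hm: "H \<in> borel_measurable M"
      unfolding H_def
    proof (intro borel_measurable_times borel_measurable_prod)
      fix i assume "i \<in> B"
      then have [measurable]: "N i \<in> measurable M (count_space UNIV)" using insert by auto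
      show "(\<lambda>\<omega>. of_bool (N i \<omega> = k i) :: real) \<in> borel_measurable M" by measurable
    next
      fix i assume "i \<in> A - insert r B"
      then have [measurable]: "N i \<in> measurable M (count_space UNIV)" by auto
      show "(\<lambda>\<omega>. s i ^ N i \<omega>) \<in> borel_measurable M" by measurable
    qed
    have H1: "\<bar>H \<omega>\<bar> \<le> 1" for \<omega>
    proof -
      have "\<bar>\<Prod>i\<in>B. of_bool (N i \<omega> = k i) :: real\<bar> \<le> 1"
        unfolding abs_prod by (intro prod_le_1) auto
      moreover have "\<bar>\<Prod>i\<in>A - insert r B. s i ^ N i \<omega>\<bar> \<le> 1"
        unfolding abs_prod using insert.prems(2) by (intro prod_le_1) (auto simp: power_le_one)
      ultimately show ?thesis unfolding H_def abs_mult by (intro mult_le_one) auto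
    qed
    have "(\<integral>\<omega>. H \<omega> * of_bool (N r \<omega> = k r) \<partial>M) = C * ?p r"
    proof (rule pgf_coefficients[OF Hm Nr H1])
      let ?c = "\<lambda>j. C * (a r ^ j / fact j * exp (- a r))"
      have c: "(\<lambda>j. ?c j * u ^ j) sums (C * exp (- (a r * (1 - u))))" for u
        using sums_mult[OF sums_poisson_pgf[of "a r" u], of C] by (simp add: mult_ac)
      then show "summable (\<lambda>j. ?c j * u ^ j)" for u by (auto simp: sums_iff)
      fix u :: real assume u: "0 < u" "u < 1"
      \<comment> \<open>The induction hypothesis is applied at \<open>s(r := u)\<close>: the
        argument of index \<open>r\<close> becomes the variable of a power series, the others stay
        fixed. This is why the induction is general in \<open>s\<close>.\<close>
      have "(\<integral>\<omega>. (\<Prod>i\<in>B. of_bool (N i \<omega> = k i)) * (\<Prod>i\<in>A - B. (s(r := u)) i ^ N i \<omega>) \<partial>M) =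
        (\<Prod>i\<in>B. ?p i) * (\<Prod>i\<in>A - B. exp (- (a i * (1 - (s(r := u)) i))))"
        using insert u by (intro insert.IH) auto
      moreover have "(\<Prod>i\<in>A - B. (s(r := u)) i ^ N i \<omega>) = u ^ N r \<omega> * (\<Prod>i\<in>A - insert r B. s i ^ N i \<omega>)" for \<omega>
        unfolding r(3) prod.insert[OF r(2,4)] by simp
      moreover have "(\<Prod>i\<in>A - B. exp (- (a i * (1 - (s(r := u)) i)))) =
          exp (- (a r * (1 - u))) * (\<Prod>i\<in>A - insert r B. exp (- (a i * (1 - s i))))"
        unfolding r(3) prod.insert[OF r(2,4)] by simp
      ultimately have "(\<integral>\<omega>. H \<omega> * u ^ N r \<omega> \<partial>M) = C * exp (- (a r * (1 - u)))"
        unfolding H_def C_def by (simp add: mult_ac)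
      then show "(\<integral>\<omega>. H \<omega> * u ^ N r \<omega> \<partial>M) = (\<Sum>j. ?c j * u ^ j)"
        using c[of u] by (simp add: sums_iff)
    qed
    then show ?case using insert.hyps unfolding H_def C_def by (simp add: mult_ac)
  qed
  have "(\<integral>\<omega>. (\<Prod>i\<in>A. of_bool (N i \<omega> = k i)) \<partial>M) = (\<Prod>i\<in>A. ?p i)"
    using step[of A "\<lambda>_. 1"] by simp
  moreover have "(\<integral>\<omega>. (\<Prod>i\<in>A. of_bool (N i \<omega> = k i)) \<partial>M) = prob {\<omega> \<in> space M. \<forall>i\<in>A. N i \<omega> = k i}"
  proof -
    have S: "{\<omega> \<in> space M. \<forall>i\<in>A. N i \<omega> = k i} \<in> events"
      using A by (intro sets.sets_Collect_finite_All) measurable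
    have "(\<integral>\<omega>. (\<Prod>i\<in>A. of_bool (N i \<omega> = k i)) \<partial>M)
        = (\<integral>\<omega>. indicat_real {\<omega> \<in> space M. \<forall>i\<in>A. N i \<omega> = k i} \<omega> \<partial>M)"
      using A by (intro Bochner_Integration.integral_cong refl) (auto simp: indicator_def prod_zero_iff)
    then show ?thesis using S by simp
  qed
  ultimately show ?thesis by simp
qed

end

text \<open>Only the coordinates in \<open>J\<close> enter, so the infinite product may be replaced
  by its marginal on \<open>J\<close>, where the integral factorises.\<close>

lemma (in product_prob_space) integral_PiM_prod_finite:
  fixes f :: "'i \<Rightarrow> 'a \<Rightarrow> real"
  assumes J: "finite J" "J \<subseteq> I" and int: "\<And>i. i \<in> J \<Longrightarrow> integrable (M i) (f i)"
  shows "(\<integral>x. (\<Prod>i\<in>J. f i (x i)) \<partial>PiM I M) = (\<Prod>i\<in>J. integral\<^sup>L (M i) (f i))"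
proof -
  have [measurable]: "f i \<in> borel_measurable (M i)" if "i \<in> J" for i using int[OF that] by simp
  have "(\<Prod>i\<in>J. integral\<^sup>L (M i) (f i)) = (\<integral>x. (\<Prod>i\<in>J. f i (x i)) \<partial>PiM J M)"
    by (rule product_integral_prod[OF J(1) int, symmetric])
  also have "\<dots> = (\<integral>x. (\<Prod>i\<in>J. f i (x i)) \<partial>distr (PiM I M) (PiM J M) (\<lambda>x. restrict x J))"
    using distr_PiM_restrict_finite[OF J] by simp
  also have "\<dots> = (\<integral>x. (\<Prod>i\<in>J. f i (restrict x J i)) \<partial>PiM I M)"
    using J by (intro integral_distr borel_measurable_prod measurable_restrict_subset) measurable
  also have "\<dots> = (\<integral>x. (\<Prod>i\<in>J. f i (x i)) \<partial>PiM I M)"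
    by (intro Bochner_Integration.integral_cong prod.cong) auto
  finally show ?thesis by simp
qed

section \<open>Existence of the Poisson measure\<close>

text \<open>The first coordinate takes countably many values, so joint measurability reduces to
  measurability of every section.\<close>

lemma measurable_pmf_split:
  fixes p :: "nat pmf"
  assumes "\<And>n. f n \<in> measurable N L"
  shows "(\<lambda>\<omega>. f (fst \<omega>) (snd \<omega>)) \<in> measurable (measure_pmf p \<Otimes>\<^sub>M N) L"
proof (rule measurable_compose_countable)
  show "(\<lambda>\<omega>. f i (snd \<omega>)) \<in> measurable (measure_pmf p \<Otimes>\<^sub>M N) L" for i
    using measurable_snd assms by (rule measurable_compose)
  have "id \<in> measurable (measure_pmf p) (count_space UNIV)" by simp
  then show "fst \<in> measurable (measure_pmf p \<Otimes>\<^sub>M N) (count_space UNIV)"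
    using measurable_compose[OF measurable_fst] by fastforce
qed

lemma integral_poisson_pmf_power:
  assumes l: "0 < l" and c: "0 \<le> (c::real)" "c \<le> 1"
  shows "(\<integral>n. c ^ n \<partial>measure_pmf (poisson_pmf l)) = exp (- (l * (1 - c)))"
\<comment> \<open>The value 1 lies outside the range of \<open>sums_pgf\<close>; there both sides
  are equal to 1.\<close>
proof (cases "c = 1")
  case False
  have pm: "(\<integral>n. of_bool (n = k) \<partial>measure_pmf (poisson_pmf l)) = l ^ k / fact k * exp (- l)" for k :: nat
  proof -
    have "(\<integral>n. of_bool (n = k) \<partial>measure_pmf (poisson_pmf l))
        = (\<integral>n. indicat_real {k} n \<partial>measure_pmf (poisson_pmf l))"
      by (intro Bochner_Integration.integral_cong) (auto simp: indicator_def)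
    also have "\<dots> = l ^ k / fact k * exp (- l)" using l by (simp add: measure_pmf_single)
    finally show ?thesis .
  qed
  have "(\<lambda>k. (\<integral>n. 1 * of_bool (n = k) \<partial>measure_pmf (poisson_pmf l)) * c ^ k) sums
      (\<integral>n. 1 * c ^ n \<partial>measure_pmf (poisson_pmf l))"
    using c False by (intro measure_pmf.sums_pgf) auto
  then have "(\<lambda>k. l ^ k / fact k * exp (- l) * c ^ k) sums (\<integral>n. c ^ n \<partial>measure_pmf (poisson_pmf l))"
    by (simp only: pm mult_1)
  then show ?thesis using sums_poisson_pgf[of l c] by (rule sums_unique2)
qed simp

text \<open>The pair of coordinates has law \<open>U \<Otimes>\<^sub>M U\<close>, and for fixed
  \<open>x\<close> the event \<open>y = x\<close> is null because \<open>U\<close> has no atoms.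
  Measurability of the off-diagonal set is a hypothesis because it depends on the space;
  \<open>sets_neq\<close> supplies it.\<close>

lemma AE_PiM_distinct:
  assumes U: "prob_space U" and atomless: "\<And>x. x \<in> space U \<Longrightarrow> {x} \<in> null_sets U"
    and diag: "{p \<in> space (U \<Otimes>\<^sub>M U). fst p \<noteq> snd p} \<in> sets (U \<Otimes>\<^sub>M U)"
    and ij: "i \<in> I" "j \<in> I" "i \<noteq> j"
  shows "AE x in PiM I (\<lambda>_. U). x i \<noteq> x j"
proof -
  interpret U: prob_space U by fact
  interpret P: product_prob_space "\<lambda>_. U" I ..
  interpret UU: pair_prob_space U U ..
  let ?f = "\<lambda>x. (x i, x j)"
  have f: "?f \<in> measurable (PiM I (\<lambda>_. U)) (U \<Otimes>\<^sub>M U)" using ij by measurable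
  have d: "U \<Otimes>\<^sub>M U = distr (PiM I (\<lambda>_. U)) (U \<Otimes>\<^sub>M U) ?f"
  proof (rule pair_measure_eqI)
    fix A B assume AB: "A \<in> sets U" "B \<in> sets U"
    have "?f -` (A \<times> B) \<inter> space (PiM I (\<lambda>_. U)) =
        {x \<in> space (PiM I (\<lambda>_. U)). \<forall>l\<in>{i, j}. x l \<in> (if l = i then A else B)}"
      using ij by auto
    then have "emeasure (distr (PiM I (\<lambda>_. U)) (U \<Otimes>\<^sub>M U) ?f) (A \<times> B) =
        (\<Prod>l\<in>{i, j}. emeasure U (if l = i then A else B))"
      using AB f ij P.emeasure_PiM_Collect[of "{i, j}" "\<lambda>l. if l = i then A else B"]
      by (simp add: emeasure_distr)
    then show "emeasure U A * emeasure U B = emeasure (distr (PiM I (\<lambda>_. U)) (U \<Otimes>\<^sub>M U) ?f) (A \<times> B)"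
      using ij by simp
  qed (auto intro: U.sigma_finite_measure_axioms)
  have "AE x in U. AE y in U. x \<noteq> y"
  proof (rule AE_I2)
    fix x assume "x \<in> space U"
    then have "AE y in U. y \<notin> {x}" by (intro AE_not_in atomless)
    then show "AE y in U. x \<noteq> y" by (rule eventually_mono) auto
  qed
  then have "AE p in U \<Otimes>\<^sub>M U. fst p \<noteq> snd p" using diag by (intro UU.AE_pair_measure) simp_all
  then have "AE p in distr (PiM I (\<lambda>_. U)) (U \<Otimes>\<^sub>M U) ?f. fst p \<noteq> snd p" unfolding d[symmetric] .
  from AE_distrD[OF f this] show ?thesis by simp
qed

lemma power_sum_swap:
  fixes s :: "'i \<Rightarrow> real"
  shows "(\<Prod>i\<in>A. s i ^ (\<Sum>l\<in>L. n l i)) = (\<Prod>l\<in>L. \<Prod>i\<in>A. s i ^ n l i)"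
  by (subst prod.swap) (simp add: power_sum)

context lc_base
begin

section \<open>Poisson processes on sets of finite measure\<close>

lemma finite_Conf: "finite A \<Longrightarrow> A \<subseteq> topspace X \<Longrightarrow> A \<in> Conf X"
  by (simp add: Conf_def)

lemma rc_Int: "E \<in> sets (borel_of X) \<Longrightarrow> rc B \<Longrightarrow> rc (E \<inter> B)"
  by (rule rc_subset[OF _ Int_lower2 sets.Int[OF _ rc_sets]])

text \<open>Writes the complement of the diagonal as a countable union of rectangles, which is what
  makes coincidence of two random points a measurable event.\<close>

lemma neq_iff_base:
  assumes "x \<in> topspace X" "y \<in> topspace X"
  shows "x \<noteq> y \<longleftrightarrow> (\<exists>p q. b p \<inter> b q = {} \<and> x \<in> b p \<and> y \<in> b q)"
proof
  assume "x \<noteq> y"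
  then obtain U V where UV: "openin X U" "openin X V" "x \<in> U" "y \<in> V" "disjnt U V"
    using Haus assms unfolding Hausdorff_space_def by blast
  obtain p where p: "x \<in> b p" "X closure_of b p \<subseteq> U" using base UV by blast
  obtain q where q: "y \<in> b q" "X closure_of b q \<subseteq> V" using base UV by blast
  have "b p \<inter> b q = {}" using p q UV b_closure unfolding disjnt_def by blast
  then show "\<exists>p q. b p \<inter> b q = {} \<and> x \<in> b p \<and> y \<in> b q" using p q by blast
qed auto

lemma sets_neq:
  assumes f: "f \<in> measurable M (borel_of X)" and g: "g \<in> measurable M (borel_of X)"
  shows "{\<omega> \<in> space M. f \<omega> \<noteq> g \<omega>} \<in> sets M"
proof -
  have sp: "f \<omega> \<in> topspace X" "g \<omega> \<in> topspace X" if "\<omega> \<in> space M" for \<omega>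
    using measurable_space[OF f that] measurable_space[OF g that] by auto
  have "{\<omega> \<in> space M. f \<omega> \<noteq> g \<omega>} = {\<omega> \<in> space M. \<exists>p q. b p \<inter> b q = {} \<and> f \<omega> \<in> b p \<and> g \<omega> \<in> b q}"
    using neq_iff_base[OF sp] by blast
  moreover have "{\<omega> \<in> space M. f \<omega> \<in> b p} \<in> sets M" "{\<omega> \<in> space M. g \<omega> \<in> b p} \<in> sets M" for p
    using f g openin_in_borel_of[OF open_b] by measurable
  then have "{\<omega> \<in> space M. \<exists>p q. b p \<inter> b q = {} \<and> f \<omega> \<in> b p \<and> g \<omega> \<in> b q} \<in> sets M"
    by (intro sets.sets_Collect_countable_Ex sets.sets_Collect_conj sets.sets_Collect_const)
  ultimately show ?thesis by simp
qed

text \<open>The joint generating function of a Poisson process living on \<open>E\<close>, seen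
  through the traces \<open>E \<inter> B i\<close>. The law is kept in this form because generating
  functions of independent pieces simply multiply.\<close>

definition cell_law :: "'a measure \<Rightarrow> real \<Rightarrow> 'a set \<Rightarrow> 'a set measure \<Rightarrow> bool" where
  "cell_law m z E P \<longleftrightarrow> prob_space P \<and> sets P = sets (borel_of (vague X)) \<and>
    (\<forall>(A::nat set) B s. finite A \<longrightarrow> disjoint_family_on B A \<longrightarrow> (\<forall>i\<in>A. rc (B i)) \<longrightarrow>
      (\<forall>i. 0 \<le> s i \<and> s i \<le> (1::real)) \<longrightarrow>
      (\<integral>\<gamma>. (\<Prod>i\<in>A. s i ^ card (\<gamma> \<inter> (E \<inter> B i))) \<partial>P) =
        exp (- (\<Sum>i\<in>A. z * measure m (E \<inter> B i) * (1 - s i))))"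

text \<open>A Poisson number of independent uniform points; \<open>g\<close> returns the empty configuration on the null
  set where points coincide, so that counts are sums of indicators.\<close>

lemma cell_process:
  assumes m: "sets m = sets (borel_of X)" and na: "\<And>x. x \<in> topspace X \<Longrightarrow> emeasure m {x} = 0"
    and E: "E \<in> sets m" "emeasure m E < \<infinity>" and z: "0 \<le> z"
  shows "\<exists>P. cell_law m z E P"
proof (cases "z * measure m E = 0")
  case True
  let ?P = "return (borel_of (vague X)) {}"
  have EX: "E \<in> sets (borel_of X)" using E(1) m by simp
  have sp: "{} \<in> space (borel_of (vague X))" by (simp add: finite_Conf)
  have 1: "(\<integral>\<gamma>. (\<Prod>i\<in>A. s i ^ card (\<gamma> \<inter> (E \<inter> B i))) \<partial>?P) =
        exp (- (\<Sum>i\<in>A. z * measure m (E \<inter> B i) * (1 - s i)))"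
    if B: "finite A" "\<forall>i\<in>A. rc (B i)" for A :: "nat set" and B and s :: "nat \<Rightarrow> real"
  proof -
    have "z * measure m (E \<inter> B i) = 0" if "i \<in> A" for i
    proof -
      have "E \<inter> B i \<in> sets m" using rc_sets[OF rc_Int[OF EX]] B(2) that m by blast
      then have "measure m (E \<inter> B i) \<le> measure m E"
        using E by (intro measure_mono_fmeasurable) (auto simp: fmeasurable_def)
      then show ?thesis using True z by (auto simp: order_antisym)
    qed
    moreover have "(\<lambda>\<gamma>. \<Prod>i\<in>A. s i ^ card (\<gamma> \<inter> (E \<inter> B i))) \<in> borel_measurable (borel_of (vague X))"
    proof (rule borel_measurable_prod)
      fix i assume "i \<in> A"
      then have "rc (E \<inter> B i)" using B(2) rc_Int[OF EX] by blast
      from measurable_compose[OF count_measurable[OF this], of "\<lambda>n. s i ^ n" borel]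
      show "(\<lambda>\<gamma>. s i ^ card (\<gamma> \<inter> (E \<inter> B i))) \<in> borel_measurable (borel_of (vague X))" by simp
    qed
    moreover have "(\<Sum>i\<in>A. z * measure m (E \<inter> B i) * (1 - s i)) = 0"
      using calculation(1) by (intro sum.neutral) simp
    ultimately show ?thesis by (simp add: integral_return[OF sp])
  qed
  show ?thesis
    unfolding cell_law_def
    by (intro exI[of _ ?P] conjI allI impI prob_space_return[OF sp] 1) auto
next
  case False
  then have zpos: "0 < z" and mE: "0 < measure m E"
    using z measure_nonneg[of m E] by (simp_all add: less_le)
  have eE: "emeasure m E \<noteq> 0" "emeasure m E \<noteq> \<infinity>"
    using mE E(2) by (simp_all add: measure_def less_top) (metis enn2real_0 less_irrefl)
  define l where "l = z * measure m E"
  have l: "0 < l" using zpos mE by (simp add: l_def)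
  define U where "U = uniform_measure m E"
  have space_m: "space m = topspace X" using sets_eq_imp_space_eq[OF m] by simp
  have sU: "sets U = sets (borel_of X)" "space U = topspace X" using m space_m by (simp_all add: U_def)
  interpret U: prob_space U unfolding U_def by (rule prob_space_uniform_measure[OF eE])
  define Q where "Q = PiM UNIV (\<lambda>_::nat. U)"
  interpret Q: product_prob_space "\<lambda>_::nat. U" UNIV ..
  have Qprob: "prob_space Q" unfolding Q_def by (rule Q.prob_space_axioms)
  interpret Q': prob_space Q by fact
  define \<Omega> where "\<Omega> = measure_pmf (poisson_pmf l) \<Otimes>\<^sub>M Q"
  interpret N: prob_space "measure_pmf (poisson_pmf l)" by (rule prob_space_measure_pmf)
  interpret NQ: pair_prob_space "measure_pmf (poisson_pmf l)" Q ..
  have \<Omega>prob: "prob_space \<Omega>" unfolding \<Omega>_def by (rule NQ.P.prob_space_axioms) 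
  have coord: "(\<lambda>x. x i) \<in> measurable Q (borel_of X)" for i
  proof -
    have "(\<lambda>x. x i) \<in> measurable Q U" unfolding Q_def by (rule measurable_component_singleton) simp
    then show ?thesis using measurable_cong_sets[OF refl sU(1), of Q] by simp
  qed
  have spQ: "x i \<in> topspace X" if "x \<in> space Q" for x i
    using measurable_space[OF coord that] by simp
  define g where "g n x = (if inj_on x {..<n} then x ` {..<n} else {})" for n and x :: "nat \<Rightarrow> 'a"
  have g_card: "card (g n x \<inter> C) = (\<Sum>i<n. of_bool (x i \<in> C))" if "inj_on x {..<n}" for n x C
  proof -
    have "g n x \<inter> C = x ` {i\<in>{..<n}. x i \<in> C}" using that by (auto simp: g_def)
    then have "card (g n x \<inter> C) = card {i\<in>{..<n}. x i \<in> C}"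
      by (simp only:) (rule card_image, rule inj_on_subset[OF that], blast)
    also have "\<dots> = (\<Sum>i<n. of_bool (x i \<in> C))"
      by (simp add: of_bool_def sum.If_cases Int_def)
    finally show ?thesis .
  qed
  have inj_sets: "{x \<in> space Q. inj_on x {..<n}} \<in> sets Q" for n :: nat
  proof -
    have "{x \<in> space Q. inj_on x {..<n}} =
        {x \<in> space Q. \<forall>i\<in>{..<n}. \<forall>j\<in>{..<n} - {i}. x i \<noteq> x j}" by (auto simp: inj_on_def)
    also have "\<dots> \<in> sets Q"
      by (intro sets.sets_Collect_finite_All sets_neq coord) auto
    finally show ?thesis .
  qed
  have in_sets: "{x \<in> space Q. x i \<in> C} \<in> sets Q" if "C \<in> sets (borel_of X)" for i C
    using measurable_sets[OF coord that, of i] by (simp add: vimage_def Int_def conj_commute)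
  have g_meas: "g n \<in> measurable Q (borel_of (vague X))" for n
  proof (rule measurable_into_Conf)
    show "g n x \<in> Conf X" if "x \<in> space Q" for x
      unfolding g_def using spQ[OF that] by (auto intro!: finite_Conf)
    fix C k assume "rc C"
    have S: "(\<lambda>x. \<Sum>i<n. of_bool (x i \<in> C) :: nat) \<in> measurable Q (count_space UNIV)"
    proof (rule measurable_sum_nat)
      fix i
      show "(\<lambda>x. of_bool (x i \<in> C) :: nat) \<in> measurable Q (count_space UNIV)"
        unfolding of_bool_def using rc_sets[OF \<open>rc C\<close>] by (intro measurable_If in_sets) auto
    qed
    have "card (g n x \<inter> C) = (if inj_on x {..<n} then \<Sum>i<n. of_bool (x i \<in> C) else 0)" for x
      using g_card[of x n C] by (cases "inj_on x {..<n}") (simp_all add: g_def)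
    moreover have "(\<lambda>x. if inj_on x {..<n} then \<Sum>i<n. of_bool (x i \<in> C) else 0 :: nat)
        \<in> measurable Q (count_space UNIV)"
      using inj_sets by (intro measurable_If S) auto
    ultimately have "(\<lambda>x. card (g n x \<inter> C)) \<in> measurable Q (count_space UNIV)" by simp
    then have "(\<lambda>x. card (g n x \<inter> C)) -` {k} \<inter> space Q \<in> sets Q" by (rule measurable_sets) simp
    then show "{x \<in> space Q. card (g n x \<inter> C) = k} \<in> sets Q"
      by (simp add: vimage_def Int_def conj_commute)
  qed
  define G where "G \<omega> = g (fst \<omega>) (snd \<omega>)" for \<omega>
  have G: "G \<in> measurable \<Omega> (borel_of (vague X))"
    unfolding G_def \<Omega>_def using g_meas by (rule measurable_pmf_split)
  have inj_AE: "AE x in Q. inj_on x {..<n}" for n :: nat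
  proof -
    have "AE x in Q. x i \<noteq> x j" if "i \<noteq> j" for i j
      unfolding Q_def
    proof (rule AE_PiM_distinct[OF U.prob_space_axioms])
      show "{x} \<in> null_sets U" if "x \<in> space U" for x
      proof -
        have x: "{x} \<in> sets m" using that sU m rc_sets[OF rc_singleton] by simp
        have "emeasure m (E \<inter> {x}) \<le> emeasure m {x}" using x by (intro emeasure_mono) auto
        then have "emeasure U {x} = 0"
          using x E na that sU unfolding U_def by simp
        then show ?thesis using x m sU by auto
      qed
      have "fst \<in> measurable (U \<Otimes>\<^sub>M U) (borel_of X)" "snd \<in> measurable (U \<Otimes>\<^sub>M U) (borel_of X)"
        using measurable_cong_sets[OF refl sU(1), of "U \<Otimes>\<^sub>M U"] by (auto simp flip: measurable_fst)
      then show "{p \<in> space (U \<Otimes>\<^sub>M U). fst p \<noteq> snd p} \<in> sets (U \<Otimes>\<^sub>M U)" by (rule sets_neq)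
    qed (use that in auto)
    then have "AE x in Q. \<forall>i\<in>{..<n}. \<forall>j\<in>{..<n} - {i}. x i \<noteq> x j"
      by (intro AE_finite_allI) auto
    then show ?thesis by (rule eventually_mono) (auto simp: inj_on_def)
  qed
  define P where "P = distr \<Omega> (borel_of (vague X)) G"
  have Pprob: "prob_space P" unfolding P_def using \<Omega>prob G by (rule prob_space.prob_space_distr)
  have sP: "sets P = sets (borel_of (vague X))" by (simp add: P_def)
  have pgf: "(\<integral>\<gamma>. (\<Prod>i\<in>A. s i ^ card (\<gamma> \<inter> (E \<inter> B i))) \<partial>P) =
        exp (- (\<Sum>i\<in>A. z * measure m (E \<inter> B i) * (1 - s i)))"
    if A: "finite A" and disj: "disjoint_family_on B A" and B: "\<forall>i\<in>A. rc (B i)"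
      and s: "\<forall>i. 0 \<le> s i \<and> s i \<le> (1::real)" for A :: "nat set" and B s
  proof -
    have rcEB: "rc (E \<inter> B i)" if "i \<in> A" for i
      using B rc_Int E(1) that unfolding m by blast
    define h where "h y = (\<Prod>i\<in>A. s i ^ of_bool (y \<in> E \<inter> B i))" for y
    \<comment> \<open>\<open>h\<close> is the contribution of a single point. By disjointness at
      most one factor differs from 1, so the product is affine in the indicators and can be
      integrated term by term.\<close>
    have h_eq: "h y = 1 - (\<Sum>i\<in>A. (1 - s i) * indicator (E \<inter> B i) y)" for y
    proof (cases "\<exists>i\<in>A. y \<in> E \<inter> B i")
      case True
      then obtain i where i: "i \<in> A" "y \<in> E \<inter> B i" by blast
      have other: "y \<notin> E \<inter> B j" if "j \<in> A - {i}" for j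
        using disj i that unfolding disjoint_family_on_def by blast
      have "h y = s i" unfolding h_def prod.remove[OF A i(1)] using i other by (simp del: Int_iff)
      moreover have "(\<Sum>i\<in>A. (1 - s i) * indicator (E \<inter> B i) y) = 1 - s i"
        unfolding sum.remove[OF A i(1)] using i other by (simp del: Int_iff)
      ultimately show ?thesis by simp
    next
      case False
      then show ?thesis unfolding h_def by (auto simp: indicator_def)
    qed
    have h01: "0 \<le> h y" "h y \<le> 1" for y
      unfolding h_def using s by (auto intro!: prod_nonneg prod_le_1 simp: power_le_one)
    have h_int: "integrable U (\<lambda>y. (1 - s i) * indicator (E \<inter> B i) y)" if "i \<in> A" for i
      using rc_sets[OF rcEB[OF that]] sU by (intro integrable_mult_right integrable_real_indicator) (auto simp: less_top[symmetric])
    have "integrable U (\<lambda>y. 1 - (\<Sum>i\<in>A. (1 - s i) * indicator (E \<inter> B i) y))"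
      by (intro Bochner_Integration.integrable_diff Bochner_Integration.integrable_sum h_int) simp
    then have hU: "integrable U h" "h \<in> borel_measurable U" unfolding h_eq[abs_def] by auto
    define c where "c = (\<integral>y. h y \<partial>U)"
    have c: "0 \<le> c" "c \<le> 1"
      unfolding c_def using h01 hU U.prob_space
      by (auto intro!: integral_nonneg U.integral_le_const)
    have c_eq: "c = 1 - (\<Sum>i\<in>A. (1 - s i) * (measure m (E \<inter> B i) / measure m E))"
    proof -
      have "c = 1 - (\<Sum>i\<in>A. (1 - s i) * measure U (E \<inter> B i))"
        unfolding c_def h_eq
        using h_int rc_sets[OF rcEB] sU U.prob_space Int_absorb2[OF rc_topspace[OF rcEB]]
        by (simp cong: sum.cong)
      moreover have "measure U (E \<inter> B i) = measure m (E \<inter> B i) / measure m E" if "i \<in> A" for i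
        using rc_sets[OF rcEB[OF that]] m eE unfolding U_def by (simp add: Int_assoc[symmetric])
      ultimately show ?thesis by simp
    qed
    have g_h: "(\<Prod>i\<in>A. s i ^ card (g n x \<inter> (E \<inter> B i))) = (\<Prod>l<n. h (x l))" if "inj_on x {..<n}" for n x
      unfolding g_card[OF that] power_sum_swap h_def ..
    have F_meas: "(\<lambda>\<gamma>. \<Prod>i\<in>A. s i ^ card (\<gamma> \<inter> (E \<inter> B i))) \<in> borel_measurable (borel_of (vague X))"
    proof (rule borel_measurable_prod)
      fix i assume "i \<in> A"
      from measurable_compose[OF count_measurable[OF rcEB[OF this]], of "\<lambda>n. s i ^ n" borel]
      show "(\<lambda>\<gamma>. s i ^ card (\<gamma> \<inter> (E \<inter> B i))) \<in> borel_measurable (borel_of (vague X))" by simp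
    qed
    have F01: "0 \<le> (\<Prod>i\<in>A. s i ^ card (\<gamma> \<inter> (E \<inter> B i)))" "(\<Prod>i\<in>A. s i ^ card (\<gamma> \<inter> (E \<inter> B i))) \<le> 1" for \<gamma>
      using s by (auto intro!: prod_nonneg prod_le_1 simp: power_le_one)
    have FG: "(\<lambda>\<omega>. \<Prod>i\<in>A. s i ^ card (G \<omega> \<inter> (E \<inter> B i))) \<in> borel_measurable \<Omega>"
      using G F_meas by (rule measurable_compose)
    have "(\<integral>\<gamma>. (\<Prod>i\<in>A. s i ^ card (\<gamma> \<inter> (E \<inter> B i))) \<partial>P) =
        (\<integral>\<omega>. (\<Prod>i\<in>A. s i ^ card (G \<omega> \<inter> (E \<inter> B i))) \<partial>\<Omega>)"
      unfolding P_def using G F_meas by (rule integral_distr)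
    also have "\<dots> = (\<integral>n. (\<integral>x. (\<Prod>i\<in>A. s i ^ card (G (n, x) \<inter> (E \<inter> B i))) \<partial>Q) \<partial>measure_pmf (poisson_pmf l))"
      unfolding \<Omega>_def
    proof (rule NQ.integral_fst'[symmetric])
      show "integrable (measure_pmf (poisson_pmf l) \<Otimes>\<^sub>M Q) (\<lambda>\<omega>. \<Prod>i\<in>A. s i ^ card (G \<omega> \<inter> (E \<inter> B i)))"
        using FG F01 unfolding \<Omega>_def by (intro NQ.P.integrable_const_bound[of _ 1]) (auto simp: abs_of_nonneg)
    qed
    also have "\<dots> = (\<integral>n. c ^ n \<partial>measure_pmf (poisson_pmf l))"
    proof (rule Bochner_Integration.integral_cong[OF refl])
      fix n
      have "(\<integral>x. (\<Prod>i\<in>A. s i ^ card (G (n, x) \<inter> (E \<inter> B i))) \<partial>Q) = (\<integral>x. (\<Prod>l<n. h (x l)) \<partial>Q)"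
      proof (rule integral_cong_AE)
        show "(\<lambda>x. \<Prod>i\<in>A. s i ^ card (G (n, x) \<inter> (E \<inter> B i))) \<in> borel_measurable Q"
          unfolding G_def fst_conv snd_conv using measurable_compose[OF g_meas F_meas] .
        have "(\<lambda>x. h (x l)) \<in> borel_measurable Q" for l
          unfolding Q_def using hU(2) by measurable
        then show "(\<lambda>x. \<Prod>l<n. h (x l)) \<in> borel_measurable Q" by (intro borel_measurable_prod)
        show "AE x in Q. (\<Prod>i\<in>A. s i ^ card (G (n, x) \<inter> (E \<inter> B i))) = (\<Prod>l<n. h (x l))"
          using inj_AE[of n] by eventually_elim (simp add: G_def g_h)
      qed
      also have "\<dots> = (\<Prod>l<n. c)"
        unfolding Q_def c_def using hU(1) by (intro Q.integral_PiM_prod_finite) auto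
      finally show "(\<integral>x. (\<Prod>i\<in>A. s i ^ card (G (n, x) \<inter> (E \<inter> B i))) \<partial>Q) = c ^ n" by simp
    qed
    also have "\<dots> = exp (- (l * (1 - c)))" by (rule integral_poisson_pmf_power[OF l c])
    \<comment> \<open>The factor \<open>measure m E\<close> in the rate \<open>l\<close> cancels the
      normalisation of the uniform law \<open>U\<close>.\<close>
    also have "l * (1 - c) = (\<Sum>i\<in>A. z * measure m (E \<inter> B i) * (1 - s i))"
      unfolding c_eq l_def using mE by (simp add: sum_distrib_left mult_ac)
    finally show ?thesis .
  qed
  show ?thesis
    unfolding cell_law_def
    by (intro exI[of _ P] conjI allI impI Pprob sP pgf) auto
qed

text \<open>The processes on the shells \<open>K (j + 1) - K j\<close> are glued independently.\<close>

lemma poisson_exists: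
  assumes m: "sets m = sets (borel_of X)" and na: "\<And>x. x \<in> topspace X \<Longrightarrow> emeasure m {x} = 0"
    and fin: "\<And>k. emeasure m (K k) < \<infinity>" and z: "0 \<le> z"
  shows "\<exists>P. is_poisson X m z P"
proof -
  define E where "E j = K (Suc j) - K j" for j
  have E: "E j \<in> sets m" "emeasure m (E j) < \<infinity>" for j
  proof -
    show Ej: "E j \<in> sets m" unfolding E_def m by (intro sets.Diff rc_sets rc_K)
    have "emeasure m (E j) \<le> emeasure m (K (Suc j))"
      unfolding E_def using rc_sets[OF rc_K] m by (intro emeasure_mono) auto
    then show "emeasure m (E j) < \<infinity>" using fin[of "Suc j"] by (rule le_less_trans)
  qed
  have EX: "E j \<in> sets (borel_of X)" for j using E m by simp
  have E_disj: "E i \<inter> E j = {}" if "i < j" for i j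
    using K_mono[of "Suc i" j] that unfolding E_def by auto
  have K_E: "K k = (\<Union>j<k. E j)" for k
  proof (induction k)
    case (Suc k)
    have "K (Suc k) = K k \<union> E k" unfolding E_def using K_mono[OF le_SucI[OF order_refl, of k]] by blast
    then show ?case using Suc by (simp add: lessThan_Suc Un_commute)
  qed (simp add: K_def)
  obtain P where law: "\<And>j. cell_law m z (E j) (P j)"
    using cell_process[OF m na E z] by metis
  have P: "prob_space (P j)" "sets (P j) = sets (borel_of (vague X))" for j
    using law[of j] by (simp_all add: cell_law_def)
  have pgf: "(\<integral>\<gamma>. (\<Prod>i\<in>A. s i ^ card (\<gamma> \<inter> (E j \<inter> B i))) \<partial>P j) =
        exp (- (\<Sum>i\<in>A. z * measure m (E j \<inter> B i) * (1 - s i)))"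
    if "finite A" "disjoint_family_on B A" "\<forall>i\<in>A. rc (B i)" "\<forall>i. 0 \<le> s i \<and> s i \<le> (1::real)"
    for j and A :: "nat set" and B s
    using law[of j] that unfolding cell_law_def by simp
  interpret Pj: prob_space "P j" for j by (rule P(1))
  define Q where "Q = PiM UNIV P"
  interpret Q: product_prob_space P UNIV ..
  interpret Q': prob_space Q unfolding Q_def by (rule Q.prob_space_axioms)
  have coord: "(\<lambda>\<omega>. \<omega> j) \<in> measurable Q (borel_of (vague X))" for j
  proof -
    have "(\<lambda>\<omega>. \<omega> j) \<in> measurable Q (P j)" unfolding Q_def by (rule measurable_component_singleton) simp
    then show ?thesis using measurable_cong_sets[OF refl P(2), of Q] by simp
  qed
  have spQ: "\<omega> j \<in> Conf X" if "\<omega> \<in> space Q" for \<omega> j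
    using measurable_space[OF coord that] by simp
  define G where "G \<omega> = (\<Union>j. \<omega> j \<inter> E j)" for \<omega> :: "nat \<Rightarrow> 'a set"
  \<comment> \<open>A set inside \<open>K k\<close> meets only the first \<open>k\<close> shells, so
    the infinite union is locally finite; local finiteness of \<open>G \<omega>\<close> and the
    formula for its counts both rest on this.\<close>
  have G_Int: "G \<omega> \<inter> C = (\<Union>j<k. \<omega> j \<inter> (E j \<inter> C))" if C: "C \<subseteq> K k" for \<omega> C k
  proof
    show "G \<omega> \<inter> C \<subseteq> (\<Union>j<k. \<omega> j \<inter> (E j \<inter> C))"
    proof
      fix x assume "x \<in> G \<omega> \<inter> C"
      then obtain j where j: "x \<in> \<omega> j" "x \<in> E j" "x \<in> C" by (auto simp: G_def)
      have "j < k"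
      proof (rule ccontr)
        assume "\<not> j < k"
        then have "K k \<subseteq> K j" by (intro K_mono) simp
        then show False using j C by (auto simp: E_def)
      qed
      then show "x \<in> (\<Union>j<k. \<omega> j \<inter> (E j \<inter> C))" using j by blast
    qed
  qed (auto simp: G_def)
  have finE: "finite (\<omega> j \<inter> (E j \<inter> C))" if "\<omega> \<in> space Q" for \<omega> j C
  proof (rule finite_subset)
    show "finite (\<omega> j \<inter> K (Suc j))" using spQ[OF that] by (simp add: Conf_iff)
  qed (auto simp: E_def)
  have G_Conf: "G \<omega> \<in> Conf X" if w: "\<omega> \<in> space Q" for \<omega>
    unfolding Conf_iff
  proof (intro conjI allI)
    show "G \<omega> \<subseteq> topspace X" using spQ[OF w] by (auto simp: G_def Conf_def)
    show "finite (G \<omega> \<inter> K k)" for k unfolding G_Int[OF order_refl] using finE[OF w] by simp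
  qed
  have G_card: "card (G \<omega> \<inter> C) = (\<Sum>j<k. card (\<omega> j \<inter> (E j \<inter> C)))"
    if "\<omega> \<in> space Q" "C \<subseteq> K k" for \<omega> C k
    unfolding G_Int[OF that(2)]
  proof (intro card_UN_disjoint ballI impI)
    fix i j :: nat assume "i \<noteq> j"
    then have "E i \<inter> E j = {}" using E_disj[of i j] E_disj[of j i] by (metis Int_commute nat_neq_iff)
    then show "\<omega> i \<inter> (E i \<inter> C) \<inter> (\<omega> j \<inter> (E j \<inter> C)) = {}" by blast
  qed (use finE[OF that(1)] in auto)
  have G: "G \<in> measurable Q (borel_of (vague X))"
  proof (rule measurable_into_Conf[OF G_Conf])
    fix C c assume C: "rc C"
    then obtain k where k: "C \<subseteq> K k" by (auto simp: rc_def)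
    have "(\<lambda>\<omega>. \<Sum>j<k. card (\<omega> j \<inter> (E j \<inter> C))) \<in> measurable Q (count_space UNIV)"
      by (intro measurable_sum_nat measurable_compose[OF coord count_measurable] rc_Int EX C)
    then have "(\<lambda>\<omega>. \<Sum>j<k. card (\<omega> j \<inter> (E j \<inter> C))) -` {c} \<inter> space Q \<in> sets Q"
      by (rule measurable_sets) simp
    moreover have "(\<lambda>\<omega>. \<Sum>j<k. card (\<omega> j \<inter> (E j \<inter> C))) -` {c} \<inter> space Q = {\<omega> \<in> space Q. card (G \<omega> \<inter> C) = c}"
      using G_card[OF _ k] by auto
    ultimately show "{\<omega> \<in> space Q. card (G \<omega> \<inter> C) = c} \<in> sets Q" by simp
  qed
  define R where "R = distr Q (borel_of (vague X)) G"
  interpret R: prob_space R unfolding R_def using G by (rule Q'.prob_space_distr)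
  have spR: "space R = Conf X" by (simp add: R_def)
  have joint: "measure R {\<gamma>\<in>Conf X. \<forall>i<n. card (\<gamma> \<inter> B i) = k i} =
          (\<Prod>i<n. (z * measure m (B i)) ^ k i / fact (k i) * exp (- (z * measure m (B i))))"
    if B: "\<forall>i<n. rc (B i)" and disj: "\<forall>i<n. \<forall>j<n. i \<noteq> j \<longrightarrow> B i \<inter> B j = {}" for n :: nat and B k
  proof -
    have "measure R {\<gamma> \<in> space R. \<forall>i\<in>{..<n}. card (\<gamma> \<inter> B i) = k i} =
          (\<Prod>i<n. (z * measure m (B i)) ^ k i / fact (k i) * exp (- (z * measure m (B i))))"
    proof (rule R.poisson_pgf_imp_joint)
      show "(\<lambda>\<gamma>. card (\<gamma> \<inter> B i)) \<in> measurable R (count_space UNIV)" if "i \<in> {..<n}" for i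
        using count_measurable[of "B i"] B that by (simp add: R_def)
      fix s :: "nat \<Rightarrow> real" assume s: "\<And>i. 0 \<le> s i \<and> s i \<le> 1"
      have "\<exists>l. \<forall>i<n. B i \<subseteq> K l"
      proof -
        obtain f where f: "\<And>i. i < n \<Longrightarrow> B i \<subseteq> K (f i)" using B unfolding rc_def by metis
        have "B i \<subseteq> K (\<Sum>i<n. f i)" if "i < n" for i
          using f[OF that] K_mono[OF member_le_sum[of i "{..<n}" f]] that by auto
        then show ?thesis by blast
      qed
      then obtain l where l: "\<And>i. i < n \<Longrightarrow> B i \<subseteq> K l" by blast
      let ?F = "\<lambda>j \<gamma>. \<Prod>i<n. s i ^ card (\<gamma> \<inter> (E j \<inter> B i))"
      have F_meas: "(\<lambda>\<gamma>. \<Prod>i<n. s i ^ card (\<gamma> \<inter> C i)) \<in> borel_measurable (borel_of (vague X))"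
        if C: "\<And>i. i < n \<Longrightarrow> rc (C i)" for C
      proof (rule borel_measurable_prod)
        fix i assume "i \<in> {..<n}"
        then have "rc (C i)" using C by simp
        from measurable_compose[OF count_measurable[OF this], of "\<lambda>n. s i ^ n" borel]
        show "(\<lambda>\<gamma>. s i ^ card (\<gamma> \<inter> C i)) \<in> borel_measurable (borel_of (vague X))" by simp
      qed
      have F01: "0 \<le> ?F j \<gamma>" "?F j \<gamma> \<le> 1" for j \<gamma>
        using s by (auto intro!: prod_nonneg prod_le_1 simp: power_le_one)
      have F_int: "integrable (P j) (?F j)" for j
      proof (rule Pj.integrable_const_bound[of _ 1])
        show "?F j \<in> borel_measurable (P j)"
          unfolding measurable_cong_sets[OF P(2) refl]
          by (rule F_meas) (use rc_Int[OF EX] B in blast)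
      qed (use F01 in \<open>simp add: abs_of_nonneg\<close>)
      have "(\<integral>\<gamma>. (\<Prod>i\<in>{..<n}. s i ^ card (\<gamma> \<inter> B i)) \<partial>R) = (\<integral>\<omega>. (\<Prod>i<n. s i ^ card (G \<omega> \<inter> B i)) \<partial>Q)"
        unfolding R_def using G F_meas[of B] B by (intro integral_distr) auto
      \<comment> \<open>Counts add up over the shells, so the powers become a product whose factors
        each involve one coordinate of \<open>\<omega>\<close>; independence then factorises the
        integral.\<close>
      also have "\<dots> = (\<integral>\<omega>. (\<Prod>j<l. ?F j (\<omega> j)) \<partial>Q)"
      proof (rule Bochner_Integration.integral_cong[OF refl])
        fix \<omega> assume w: "\<omega> \<in> space Q"
        have "(\<Prod>i<n. s i ^ card (G \<omega> \<inter> B i)) = (\<Prod>i<n. s i ^ (\<Sum>j<l. card (\<omega> j \<inter> (E j \<inter> B i))))"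
          using G_card[OF w l] by (intro prod.cong refl) simp
        then show "(\<Prod>i<n. s i ^ card (G \<omega> \<inter> B i)) = (\<Prod>j<l. ?F j (\<omega> j))"
          unfolding power_sum_swap .
      qed
      also have "\<dots> = (\<Prod>j<l. integral\<^sup>L (P j) (?F j))"
        unfolding Q_def using F_int by (intro Q.integral_PiM_prod_finite) auto
      also have "\<dots> = (\<Prod>j<l. exp (- (\<Sum>i<n. z * measure m (E j \<inter> B i) * (1 - s i))))"
        using B disj s by (intro prod.cong refl pgf) (auto simp: disjoint_family_on_def)
      also have "\<dots> = exp (- (\<Sum>j<l. \<Sum>i<n. z * measure m (E j \<inter> B i) * (1 - s i)))"
        by (simp only: sum_negf[symmetric] exp_sum[OF finite_lessThan])
      also have "(\<Sum>j<l. \<Sum>i<n. z * measure m (E j \<inter> B i) * (1 - s i)) =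
          (\<Sum>i<n. z * (\<Sum>j<l. measure m (E j \<inter> B i)) * (1 - s i))"
        by (subst sum.swap) (simp add: sum_distrib_left sum_distrib_right)
      also have "\<dots> = (\<Sum>i<n. z * measure m (B i) * (1 - s i))"
      proof (rule sum.cong[OF refl])
        fix i assume "i \<in> {..<n}"
        then have i: "i < n" by simp
        have "B i = (\<Union>j<l. E j \<inter> B i)" using l[OF i] K_E by blast
        moreover have "measure m (\<Union>j<l. E j \<inter> B i) = (\<Sum>j<l. measure m (E j \<inter> B i))"
        proof (rule measure_finite_Union)
          have Bm: "B i \<in> sets m" using rc_sets B i m by blast
          then show "(\<lambda>j. E j \<inter> B i) ` {..<l} \<subseteq> sets m" using E by auto
          show "emeasure m (E j \<inter> B i) \<noteq> \<infinity>" for j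
          proof -
            have "emeasure m (E j \<inter> B i) \<le> emeasure m (E j)" using E by (intro emeasure_mono) auto
            then show ?thesis using E(2)[of j] by (auto simp: top_unique)
          qed
          have "E p \<inter> E q = {}" if "p \<noteq> q" for p q
            using that E_disj[of p q] E_disj[of q p] by (metis Int_commute nat_neq_iff)
          then show "disjoint_family_on (\<lambda>j. E j \<inter> B i) {..<l}" unfolding disjoint_family_on_def by blast
        qed simp
        ultimately show "z * (\<Sum>j<l. measure m (E j \<inter> B i)) * (1 - s i) = z * measure m (B i) * (1 - s i)"
          by simp
      qed
      finally show "(\<integral>\<gamma>. (\<Prod>i\<in>{..<n}. s i ^ card (\<gamma> \<inter> B i)) \<partial>R) =
          (\<Prod>i<n. exp (- (z * measure m (B i) * (1 - s i))))"
        by (simp only: sum_negf[symmetric] exp_sum[OF finite_lessThan])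
    qed simp
    then show ?thesis by (simp add: spR Ball_def)
  qed
  have "is_poisson X m z R"
    unfolding is_poisson_def
  proof (intro conjI allI impI)
    show "prob_space R" by (rule R.prob_space_axioms)
    show "sets R = sets (borel_of (vague X))" by (simp add: R_def)
    fix n :: nat and B :: "nat \<Rightarrow> 'a set" and k
    assume B: "\<forall>i<n. B i \<in> sets m \<and> compactin X (X closure_of B i)"
      and d: "\<forall>i<n. \<forall>j<n. i \<noteq> j \<longrightarrow> B i \<inter> B j = {}"
    have "\<forall>i<n. rc (B i)" using B m by (simp add: rc_iff)
    then show "measure R {\<gamma>\<in>Conf X. \<forall>i<n. card (\<gamma> \<inter> B i) = k i} =
          (\<Prod>i<n. (z * measure m (B i)) ^ k i / fact (k i) * exp (- (z * measure m (B i))))"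
      using d by (rule joint)
  qed
  then show ?thesis by blast
qed

end

section \<open>The Feller property\<close>

lemma measurable_snd_cong:
  assumes "sets N = sets L"
  shows "snd \<in> measurable (M \<Otimes>\<^sub>M N) L"
  unfolding measurable_cong_sets[OF refl assms[symmetric]] by (rule measurable_snd)

context lc_base
begin

lemma is_poisson_poisson_measure:
  assumes m: "sets m = sets (borel_of X)" and na: "\<And>x. x \<in> topspace X \<Longrightarrow> emeasure m {x} = 0"
    and fin: "\<And>k. emeasure m (K k) < \<infinity>" and z: "0 \<le> z"
  shows "is_poisson X m z (poisson_measure X m z)"
proof -
  obtain P where P: "is_poisson X m z P" using poisson_exists[OF m na fin z] by blast
  then show ?thesis
    unfolding poisson_measure_def using is_poisson_unique[OF _ P m] by (rule theI)
qed

text \<open>The count of \<open>{x}\<close> is Poisson with mean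
  \<open>z * measure m {x} = 0\<close>, so it is 0 with probability 1.\<close>

lemma is_poisson_AE_avoids:
  assumes p: "is_poisson X m z \<pi>" and m: "sets m = sets (borel_of X)"
    and x: "x \<in> topspace X" "emeasure m {x} = 0"
  shows "AE \<eta> in \<pi>. x \<notin> \<eta>"
proof -
  interpret prob_space \<pi> using p by (simp add: is_poisson_def)
  have s\<pi>: "sets \<pi> = sets (borel_of (vague X))" using p by (simp add: is_poisson_def)
  have sp: "space \<pi> = Conf X" using sets_eq_imp_space_eq[OF s\<pi>] by simp
  have "prob (cyl {{x}} (\<lambda>_. 0)) = 1"
    using is_poisson_cyl[OF p m, of "{{x}}" "\<lambda>_. 0"] rc_singleton[OF x(1)] x(2)
    by (simp add: disjoint_def measure_def)
  moreover have "cyl {{x}} (\<lambda>_. 0) \<in> events"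
    using cyl_sets[of "{{x}}"] rc_singleton[OF x(1)] s\<pi> by simp
  ultimately have "AE \<eta> in \<pi>. \<eta> \<in> cyl {{x}} (\<lambda>_. 0)" using AE_prob_1 by blast
  then show ?thesis by eventually_elim (auto simp: cyl_def)
qed

text \<open>The labelling \<open>\<tau>\<close> covers two uses at once: the identity with index set
  \<open>\<gamma>\<close> for the kernel itself, and the matching labels with index set
  \<open>UNIV\<close> for the coupling.\<close>

lemma measurable_superposition:
  assumes g: "\<gamma> \<in> Conf X" and \<tau>: "\<tau> ` \<gamma> \<subseteq> I" and s\<pi>: "sets \<pi> = sets (borel_of (vague X))"
  shows "(\<lambda>(a, \<eta>). {x \<in> \<gamma>. a (\<tau> x)} \<union> \<eta>) \<in>
    measurable (PiM I (\<lambda>_. measure_pmf (p :: bool pmf)) \<Otimes>\<^sub>M \<pi>) (borel_of (vague X))"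
proof (rule measurable_into_Conf)
  let ?M = "PiM I (\<lambda>_. measure_pmf p) \<Otimes>\<^sub>M \<pi>"
  have sp: "space \<pi> = Conf X" using sets_eq_imp_space_eq[OF s\<pi>] by simp
  have snd: "snd \<omega> \<in> Conf X" if "\<omega> \<in> space ?M" for \<omega>
    using that sp by (simp add: space_pair_measure mem_Times_iff)
  have thin: "{x \<in> \<gamma>. a (\<tau> x)} \<in> Conf X" for a by (rule Conf_subset[OF g]) auto
  show "(case \<omega> of (a, \<eta>) \<Rightarrow> {x \<in> \<gamma>. a (\<tau> x)} \<union> \<eta>) \<in> Conf X" if "\<omega> \<in> space ?M" for \<omega>
    using Conf_Un[OF thin snd[OF that]] by (simp add: case_prod_beta)
  fix B k assume B: "rc B"
  let ?S = "\<gamma> \<inter> B"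
  have finS: "finite ?S" by (rule finite_Conf_rc[OF g B])
  have count_snd: "(\<lambda>\<omega>. card (snd \<omega> \<inter> C)) \<in> measurable ?M (count_space UNIV)" if "rc C" for C
    by (rule measurable_compose[OF measurable_snd_cong[OF s\<pi>] count_measurable[OF that]])
  have bern: "{\<omega> \<in> space ?M. fst \<omega> (\<tau> x)} \<in> sets ?M" if "x \<in> \<gamma>" for x
  proof -
    have "(\<lambda>a. a (\<tau> x)) \<in> measurable (PiM I (\<lambda>_. measure_pmf p)) (measure_pmf p)"
      using \<tau> that by (intro measurable_component_singleton) auto
    then have "(\<lambda>\<omega>. fst \<omega> (\<tau> x)) \<in> measurable ?M (measure_pmf p)"
      by (rule measurable_compose[OF measurable_fst])
    then have "(\<lambda>\<omega>. fst \<omega> (\<tau> x)) -` {True} \<inter> space ?M \<in> sets ?M" by (rule measurable_sets) simp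
    then show ?thesis by (simp add: vimage_def Int_def conj_commute)
  qed
  \<comment> \<open>A retained point that also belongs to the second component must not be counted
    twice. Its absence is expressed as a vanishing count because counts are known to be
    measurable.\<close>
  let ?f = "\<lambda>\<omega>. (\<Sum>x\<in>?S. if fst \<omega> (\<tau> x) \<and> card (snd \<omega> \<inter> {x}) = 0 then 1 else 0 :: nat) + card (snd \<omega> \<inter> B)"
  have "(\<lambda>\<omega>. \<Sum>x\<in>?S. if fst \<omega> (\<tau> x) \<and> card (snd \<omega> \<inter> {x}) = 0 then 1 else 0 :: nat)
      \<in> measurable ?M (count_space UNIV)"
  proof (intro measurable_sum_nat measurable_If measurable_const)
    fix x assume x: "x \<in> ?S"
    then have "rc {x}" using g by (intro rc_singleton) (auto simp: Conf_def)
    then have "(\<lambda>\<omega>. card (snd \<omega> \<inter> {x})) -` {0} \<inter> space ?M \<in> sets ?M"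
      by (intro measurable_sets[OF count_snd]) auto
    then have "{\<omega> \<in> space ?M. card (snd \<omega> \<inter> {x}) = 0} \<in> sets ?M"
      by (simp only: vimage_def Int_def mem_Collect_eq singleton_iff conj_commute)
    then show "{\<omega> \<in> space ?M. fst \<omega> (\<tau> x) \<and> card (snd \<omega> \<inter> {x}) = 0} \<in> sets ?M"
      using bern x by (intro sets.sets_Collect_conj) auto
  qed auto
  then have f: "?f \<in> measurable ?M (count_space UNIV)"
    using count_snd[OF B] by measurable
  have "card ((case \<omega> of (a, \<eta>) \<Rightarrow> {x \<in> \<gamma>. a (\<tau> x)} \<union> \<eta>) \<inter> B) = ?f \<omega>" if w: "\<omega> \<in> space ?M" for \<omega>
  proof -
    have "(case \<omega> of (a, \<eta>) \<Rightarrow> {x \<in> \<gamma>. a (\<tau> x)} \<union> \<eta>) \<inter> B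
       = {x \<in> ?S. fst \<omega> (\<tau> x) \<and> x \<notin> snd \<omega>} \<union> (snd \<omega> \<inter> B)"
      by (auto simp: case_prod_beta)
    also have "card \<dots> = card {x \<in> ?S. fst \<omega> (\<tau> x) \<and> x \<notin> snd \<omega>} + card (snd \<omega> \<inter> B)"
    proof (rule card_Un_disjoint)
      show "finite {x \<in> ?S. fst \<omega> (\<tau> x) \<and> x \<notin> snd \<omega>}" using finS by (rule finite_subset[rotated]) auto
      show "finite (snd \<omega> \<inter> B)" by (rule finite_Conf_rc[OF snd[OF w] B])
    qed auto
    also have "card {x \<in> ?S. fst \<omega> (\<tau> x) \<and> x \<notin> snd \<omega>} =
        (\<Sum>x\<in>?S. if fst \<omega> (\<tau> x) \<and> card (snd \<omega> \<inter> {x}) = 0 then 1 else 0)"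
    proof -
      have "card (snd \<omega> \<inter> {x}) = 0 \<longleftrightarrow> x \<notin> snd \<omega>" for x by auto
      then show ?thesis using finS by (simp add: sum.If_cases Int_def)
    qed
    finally show ?thesis .
  qed
  then have "{\<omega> \<in> space ?M. card ((case \<omega> of (a, \<eta>) \<Rightarrow> {x \<in> \<gamma>. a (\<tau> x)} \<union> \<eta>) \<inter> B) = k} = ?f -` {k} \<inter> space ?M"
    by auto
  then show "{\<omega> \<in> space ?M. card ((case \<omega> of (a, \<eta>) \<Rightarrow> {x \<in> \<gamma>. a (\<tau> x)} \<union> \<eta>) \<inter> B) = k} \<in> sets ?M"
    using measurable_sets[OF f, of "{k}"] by simp
qed

text \<open>Reading an independent, identically distributed family through an injective
  \<open>\<tau>\<close> again gives such a family indexed by \<open>\<gamma>\<close>. Hence the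
  kernels at different configurations can all be represented on one space that does not depend on
  \<open>\<gamma>\<close>.\<close>

lemma integral_PP_coupling:
  fixes F :: "'a set \<Rightarrow> real" and \<tau> :: "'a \<Rightarrow> 'b"
  assumes F: "F \<in> borel_measurable (borel_of (vague X))" and t: "t \<noteq> 0"
    and \<pi>: "prob_space (poisson_measure X m (1 - exp (- t)))"
      "sets (poisson_measure X m (1 - exp (- t))) = sets (borel_of (vague X))"
    and g: "\<gamma> \<in> Conf X" and inj: "inj_on \<tau> \<gamma>"
  shows "(\<integral>\<eta>. F \<eta> \<partial>PP X m t \<gamma>) =
    (\<integral>(a, \<eta>). F ({x \<in> \<gamma>. a (\<tau> x)} \<union> \<eta>)
      \<partial>(PiM UNIV (\<lambda>_. measure_pmf (bernoulli_pmf (exp (- t)))) \<Otimes>\<^sub>M poisson_measure X m (1 - exp (- t))))"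
proof -
  let ?\<pi> = "poisson_measure X m (1 - exp (- t))"
  let ?B = "measure_pmf (bernoulli_pmf (exp (- t)))"
  interpret \<pi>: prob_space ?\<pi> by (rule \<pi>(1))
  let ?r = "\<lambda>a. \<lambda>x\<in>\<gamma>. a (\<tau> x)"
  have r: "?r \<in> measurable (PiM UNIV (\<lambda>_. ?B)) (PiM \<gamma> (\<lambda>_. ?B))"
    by (intro measurable_restrict measurable_component_singleton) auto
  have "distr (PiM UNIV (\<lambda>_. ?B)) (PiM \<gamma> (\<lambda>_. ?B)) ?r = PiM \<gamma> (\<lambda>_. ?B)"
    using inj by (intro distr_PiM_reindex prob_space_measure_pmf) auto
  moreover have "distr (PiM UNIV (\<lambda>_. ?B)) (PiM \<gamma> (\<lambda>_. ?B)) ?r \<Otimes>\<^sub>M distr ?\<pi> ?\<pi> (\<lambda>x. x) =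
     distr (PiM UNIV (\<lambda>_. ?B) \<Otimes>\<^sub>M ?\<pi>) (PiM \<gamma> (\<lambda>_. ?B) \<Otimes>\<^sub>M ?\<pi>) (\<lambda>(a, \<eta>). (?r a, \<eta>))"
    using r by (rule pair_measure_distr) (simp_all add: \<pi>.sigma_finite_measure_axioms)
  ultimately have d: "PiM \<gamma> (\<lambda>_. ?B) \<Otimes>\<^sub>M ?\<pi> =
     distr (PiM UNIV (\<lambda>_. ?B) \<Otimes>\<^sub>M ?\<pi>) (PiM \<gamma> (\<lambda>_. ?B) \<Otimes>\<^sub>M ?\<pi>) (\<lambda>(a, \<eta>). (?r a, \<eta>))"
    by simp
  have rr: "(\<lambda>(a, \<eta>). (?r a, \<eta>)) \<in> measurable (PiM UNIV (\<lambda>_. ?B) \<Otimes>\<^sub>M ?\<pi>) (PiM \<gamma> (\<lambda>_. ?B) \<Otimes>\<^sub>M ?\<pi>)"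
    using r by measurable
  have S: "(\<lambda>(a, \<eta>). {x \<in> \<gamma>. a x} \<union> \<eta>) \<in> measurable (PiM \<gamma> (\<lambda>_. ?B) \<Otimes>\<^sub>M ?\<pi>) (borel_of (vague X))"
    using measurable_superposition[OF g _ \<pi>(2), of "\<lambda>x. x" \<gamma>] by simp
  have "(\<integral>\<eta>. F \<eta> \<partial>PP X m t \<gamma>) = (\<integral>\<omega>. F (case \<omega> of (a, \<eta>) \<Rightarrow> {x \<in> \<gamma>. a x} \<union> \<eta>) \<partial>(PiM \<gamma> (\<lambda>_. ?B) \<Otimes>\<^sub>M ?\<pi>))"
    unfolding PP_def if_not_P[OF t] by (rule integral_distr[OF S F])
  also have "\<dots> = (\<integral>\<omega>. F (case (case \<omega> of (a, \<eta>) \<Rightarrow> (?r a, \<eta>)) of (a, \<eta>) \<Rightarrow> {x \<in> \<gamma>. a x} \<union> \<eta>)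
      \<partial>(PiM UNIV (\<lambda>_. ?B) \<Otimes>\<^sub>M ?\<pi>))"
    by (subst d, rule integral_distr[OF rr measurable_compose[OF S F]])
  also have "\<dots> = (\<integral>(a, \<eta>). F ({x \<in> \<gamma>. a (\<tau> x)} \<union> \<eta>) \<partial>(PiM UNIV (\<lambda>_. ?B) \<Otimes>\<^sub>M ?\<pi>))"
  proof (rule Bochner_Integration.integral_cong[OF refl])
    fix \<omega> :: "('b \<Rightarrow> bool) \<times> 'a set"
    have "{x \<in> \<gamma>. (\<lambda>x\<in>\<gamma>. fst \<omega> (\<tau> x)) x} = {x \<in> \<gamma>. fst \<omega> (\<tau> x)}" by auto
    then show "F (case (case \<omega> of (a, \<eta>) \<Rightarrow> (?r a, \<eta>)) of (a, \<eta>) \<Rightarrow> {x \<in> \<gamma>. a x} \<union> \<eta>) =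
      (case \<omega> of (a, \<eta>) \<Rightarrow> F ({x \<in> \<gamma>. a (\<tau> x)} \<union> \<eta>))"
      by (simp add: case_prod_beta)
  qed
  finally show ?thesis .
qed

text \<open>On the common space the integrands converge almost surely by continuity of
  \<open>F\<close>, and the bound \<open>C\<close> on \<open>F\<close> dominates them.\<close>

lemma integral_PP_tendsto:
  assumes F: "continuous_map (vague X) euclideanreal F" and bd: "\<And>\<eta>. \<eta> \<in> Conf X \<Longrightarrow> \<bar>F \<eta>\<bar> \<le> C"
    and t: "t \<noteq> 0" and \<pi>: "is_poisson X m (1 - exp (- t)) (poisson_measure X m (1 - exp (- t)))"
    and m: "sets m = sets (borel_of X)" and na: "\<And>x. x \<in> topspace X \<Longrightarrow> emeasure m {x} = 0"
    and g: "\<gamma> \<in> Conf X" and c: "\<And>k. cells \<gamma> k (N k)" and w: "\<And>k. g k \<in> W k (N k ` (\<gamma> \<inter> K k))"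
  shows "(\<lambda>k. \<integral>\<eta>. F \<eta> \<partial>PP X m t (g k)) \<longlonglongrightarrow> (\<integral>\<eta>. F \<eta> \<partial>PP X m t \<gamma>)"
proof -
  let ?\<pi> = "poisson_measure X m (1 - exp (- t))"
  let ?B = "measure_pmf (bernoulli_pmf (exp (- t)))"
  let ?M = "PiM UNIV (\<lambda>_::'a. ?B) \<Otimes>\<^sub>M ?\<pi>"
  have prob: "prob_space ?\<pi>" and s\<pi>: "sets ?\<pi> = sets (borel_of (vague X))"
    using \<pi> by (simp_all add: is_poisson_def)
  have sp: "space ?\<pi> = Conf X" using sets_eq_imp_space_eq[OF s\<pi>] by simp
  interpret \<pi>: prob_space ?\<pi> by fact
  interpret B: prob_space "PiM UNIV (\<lambda>_::'a. ?B)" by (intro prob_space_PiM prob_space_measure_pmf)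
  interpret P: pair_prob_space "PiM UNIV (\<lambda>_::'a. ?B)" ?\<pi> ..
  have Fm: "F \<in> borel_measurable (borel_of (vague X))" by (rule continuous_map_imp_borel_measurable[OF F])
  have gC: "g k \<in> Conf X" for k using w[of k] by (auto simp: W_def)
  define \<tau> where "\<tau> k = tau \<gamma> k (N k)" for k
  let ?f = "\<lambda>\<gamma> \<tau> (\<omega> :: ('a \<Rightarrow> bool) \<times> 'a set). F ({x \<in> \<gamma>. fst \<omega> (\<tau> x)} \<union> snd \<omega>)"
  have meas: "?f \<gamma>' \<tau>' \<in> borel_measurable ?M" if "\<gamma>' \<in> Conf X" for \<gamma>' \<tau>'
    using measurable_compose[OF measurable_superposition[OF that _ s\<pi>, of \<tau>' UNIV] Fm]
    by (simp add: case_prod_beta)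
  have eq: "(\<integral>\<eta>. F \<eta> \<partial>PP X m t \<gamma>') = (\<integral>\<omega>. ?f \<gamma>' \<tau>' \<omega> \<partial>?M)" if "\<gamma>' \<in> Conf X" "inj_on \<tau>' \<gamma>'" for \<gamma>' \<tau>'
    using integral_PP_coupling[OF Fm t prob s\<pi> that] unfolding case_prod_unfold .
  \<comment> \<open>All points that the Poisson part must avoid along the whole sequence.
    Countability of \<open>S\<close> allows the exceptional null sets to be united.\<close>
  define S where "S = \<gamma> \<union> (\<Union>k. g k)"
  have S: "countable S" "S \<subseteq> topspace X"
    using countable_Conf[OF g] countable_Conf[OF gC] g gC by (auto simp: S_def Conf_def)
  have avoid: "AE \<omega> in ?M. x \<notin> snd \<omega>" if x: "x \<in> S" for x
  proof (rule P.AE_pair_measure)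
    have rcx: "rc {x}" using x S by (intro rc_singleton) auto
    have snd: "snd \<in> measurable ?M (borel_of (vague X))"
      by (rule measurable_snd_cong[OF s\<pi>])
    have *: "{\<omega> \<in> space ?M. x \<notin> snd \<omega>} = snd -` {\<eta> \<in> Conf X. card (\<eta> \<inter> {x}) = 0} \<inter> space ?M"
      using measurable_space[OF snd] by auto
    show "{\<omega> \<in> space ?M. x \<notin> snd \<omega>} \<in> sets ?M"
      unfolding * by (rule measurable_sets[OF snd count_sets[OF rcx]])
    show "AE a in PiM UNIV (\<lambda>_. ?B). AE \<eta> in ?\<pi>. x \<notin> snd (a, \<eta>)"
      using is_poisson_AE_avoids[OF \<pi> m _ na] x S by auto
  qed
  have "AE \<omega> in ?M. \<forall>x\<in>S. x \<notin> snd \<omega>" using avoid S(1) by (intro AE_ball_countable')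
  \<comment> \<open>In the limit the labels are the identity, since the points of
    \<open>\<gamma>\<close> are the labels. Only the Poisson component restricts the set of
    convergence; the Bernoulli field is arbitrary.\<close>
  then have lim: "AE \<omega> in ?M. (\<lambda>k. ?f (g k) (\<tau> k) \<omega>) \<longlonglongrightarrow> ?f \<gamma> (\<lambda>x. x) \<omega>"
    using AE_space
  proof eventually_elim
    case (elim \<omega>)
    have "snd \<omega> \<in> Conf X" using elim sp by (simp add: space_pair_measure mem_Times_iff)
    then have L: "limitin (vague X) (\<lambda>k. {y \<in> g k. fst \<omega> (tau \<gamma> k (N k) y)} \<union> snd \<omega>)
        ({x \<in> \<gamma>. fst \<omega> x} \<union> snd \<omega>) sequentially"
      using elim by (intro thinning_superposition_limit[OF g c w]) (auto simp: S_def)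
    show ?case
    proof (rule topological_tendstoI)
      fix V :: "real set" assume V: "open V" "?f \<gamma> (\<lambda>x. x) \<omega> \<in> V"
      have "openin (vague X) {\<eta> \<in> topspace (vague X). F \<eta> \<in> V}"
        using F V(1) by (auto simp: continuous_map_def)
      moreover have "{x \<in> \<gamma>. fst \<omega> x} \<union> snd \<omega> \<in> {\<eta> \<in> topspace (vague X). F \<eta> \<in> V}"
        using L V(2) by (auto simp: limitin_def)
      ultimately have "eventually (\<lambda>k. {y \<in> g k. fst \<omega> (tau \<gamma> k (N k) y)} \<union> snd \<omega>
          \<in> {\<eta> \<in> topspace (vague X). F \<eta> \<in> V}) sequentially"
        using L unfolding limitin_def by blast
      then show "eventually (\<lambda>k. ?f (g k) (\<tau> k) \<omega> \<in> V) sequentially"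
        by eventually_elim (simp add: \<tau>_def)
    qed
  qed
  have "(\<lambda>k. \<integral>\<omega>. ?f (g k) (\<tau> k) \<omega> \<partial>?M) \<longlonglongrightarrow> (\<integral>\<omega>. ?f \<gamma> (\<lambda>x. x) \<omega> \<partial>?M)"
  proof (rule integral_dominated_convergence[where w = "\<lambda>_. C", OF meas[OF g] meas[OF gC] _ lim])
    show "integrable ?M (\<lambda>_. C)" by (rule P.integrable_const)
    show "AE \<omega> in ?M. norm (?f (g k) (\<tau> k) \<omega>) \<le> C" for k
    proof (rule AE_I2)
      fix \<omega> assume "\<omega> \<in> space ?M"
      then have "snd \<omega> \<in> Conf X" using sp by (simp add: space_pair_measure mem_Times_iff)
      moreover have "{x \<in> g k. fst \<omega> (\<tau> k x)} \<in> Conf X" by (rule Conf_subset[OF gC]) auto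
      ultimately show "norm (?f (g k) (\<tau> k) \<omega>) \<le> C" using bd[OF Conf_Un] by simp
    qed
  qed
  moreover have "inj_on (\<tau> k) (g k)" for k unfolding \<tau>_def by (rule inj_on_tau[OF c w])
  then have "(\<integral>\<eta>. F \<eta> \<partial>PP X m t (g k)) = (\<integral>\<omega>. ?f (g k) (\<tau> k) \<omega> \<partial>?M)" for k
    by (rule eq[OF gC])
  ultimately show ?thesis using eq[OF g, of "\<lambda>x. x"] by simp
qed

text \<open>If no open neighbourhood of \<open>\<gamma>\<close> were mapped into \<open>V\<close>,
  the open set inside each of the sets \<open>W\<close> would contain a configuration with value
  outside \<open>V\<close>. Such a sequence contradicts \<open>integral_PP_tendsto\<close>.\<close>

lemma continuous_map_integral_PP:
  assumes F: "continuous_map (vague X) euclideanreal F" and bd: "\<And>\<eta>. \<eta> \<in> Conf X \<Longrightarrow> \<bar>F \<eta>\<bar> \<le> C"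
    and t: "t \<noteq> 0" and \<pi>: "is_poisson X m (1 - exp (- t)) (poisson_measure X m (1 - exp (- t)))"
    and m: "sets m = sets (borel_of X)" and na: "\<And>x. x \<in> topspace X \<Longrightarrow> emeasure m {x} = 0"
  shows "continuous_map (vague X) euclideanreal (\<lambda>\<gamma>. \<integral>\<eta>. F \<eta> \<partial>PP X m t \<gamma>)"
proof -
  define J where "J \<gamma> = (\<integral>\<eta>. F \<eta> \<partial>PP X m t \<gamma>)" for \<gamma>
  have "openin (vague X) {\<gamma> \<in> topspace (vague X). J \<gamma> \<in> V}" if V: "open V" for V
  proof (subst openin_subopen, intro ballI)
    fix \<gamma> assume "\<gamma> \<in> {\<gamma> \<in> topspace (vague X). J \<gamma> \<in> V}"
    then have g: "\<gamma> \<in> Conf X" "J \<gamma> \<in> V" by auto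
    show "\<exists>T. openin (vague X) T \<and> \<gamma> \<in> T \<and> T \<subseteq> {\<gamma> \<in> topspace (vague X). J \<gamma> \<in> V}"
    proof (rule ccontr)
      assume neg: "\<not> ?thesis"
      obtain N where N: "\<And>k. cells \<gamma> k (N k)" using cells_exists[OF g(1)] by metis
      have "\<exists>\<eta>. \<eta> \<in> W k (N k ` (\<gamma> \<inter> K k)) \<and> J \<eta> \<notin> V" for k
      proof -
        obtain G where G: "openin (vague X) G" "\<gamma> \<in> G" "G \<subseteq> W k (N k ` (\<gamma> \<inter> K k))"
          using W_neighbourhood[OF g(1) N[of k]] by blast
        then have "\<not> G \<subseteq> {\<gamma> \<in> topspace (vague X). J \<gamma> \<in> V}" using neg by blast
        moreover have "G \<subseteq> topspace (vague X)" by (rule openin_subset[OF G(1)])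
        ultimately show ?thesis using G(3) by blast
      qed
      then obtain h where h: "\<And>k. h k \<in> W k (N k ` (\<gamma> \<inter> K k))" "\<And>k. J (h k) \<notin> V" by metis
      have "(\<lambda>k. J (h k)) \<longlonglongrightarrow> J \<gamma>"
        unfolding J_def by (rule integral_PP_tendsto[OF F bd t \<pi> m na g(1) N h(1)])
      then have "eventually (\<lambda>k. J (h k) \<in> V) sequentially" using V g(2) by (rule topological_tendstoD)
      then show False using h(2) by auto
    qed
  qed
  then show ?thesis unfolding continuous_map_def J_def by auto
qed

end

section \<open>Boundedness and conclusion\<close>

lemma abs_integral_vague_le:
  fixes F :: "'a set \<Rightarrow> real"
  assumes F: "F \<in> borel_measurable (borel_of (vague X))" and bd: "\<And>\<eta>. \<eta> \<in> Conf X \<Longrightarrow> \<bar>F \<eta>\<bar> \<le> C"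
    and P: "prob_space P" "sets P = sets (borel_of (vague X))"
  shows "\<bar>\<integral>\<eta>. F \<eta> \<partial>P\<bar> \<le> C"
proof -
  interpret prob_space P by fact
  have sp: "space P = Conf X" using sets_eq_imp_space_eq[OF P(2)] by simp
  have Fm: "F \<in> borel_measurable P" using F measurable_cong_sets[OF P(2) refl] by blast
  have int: "integrable P F" using bd sp Fm by (intro integrable_const_bound[of _ C]) auto
  have "\<bar>\<integral>\<eta>. F \<eta> \<partial>P\<bar> \<le> (\<integral>\<eta>. \<bar>F \<eta>\<bar> \<partial>P)" by (rule integral_abs_bound)
  also have "\<dots> \<le> (\<integral>\<eta>. C \<partial>P)" using int bd sp by (intro integral_mono) auto
  finally show ?thesis by (simp add: prob_space)
qed

theorem theorem2:
  fixes X :: "'a topology" and m :: "'a measure" and t :: real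
    and F :: "'a set \<Rightarrow> real"
  assumes "locally_compact_space X" and "second_countable X" and "Hausdorff_space X"
    and "radon_measure X m" and "non_atomic X m"
    and "t \<ge> 0"
    and "continuous_map (vague X) euclideanreal F" and "bounded (F ` Conf X)"
  shows "continuous_map (vague X) euclideanreal (\<lambda>\<gamma>. \<integral>\<eta>. F \<eta> \<partial>(PP X m t \<gamma>))
    \<and> bounded ((\<lambda>\<gamma>. \<integral>\<eta>. F \<eta> \<partial>(PP X m t \<gamma>)) ` Conf X)"
proof -
  have Fm: "F \<in> borel_measurable (borel_of (vague X))"
    by (rule continuous_map_imp_borel_measurable[OF assms(7)])
  show ?thesis
  proof (cases "t = 0")
    case True
    have eq: "(\<integral>\<eta>. F \<eta> \<partial>(PP X m t \<gamma>)) = F \<gamma>" if "\<gamma> \<in> Conf X" for \<gamma>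
      using that True Fm by (simp add: PP_def integral_return)
    have "continuous_map (vague X) euclideanreal (\<lambda>\<gamma>. \<integral>\<eta>. F \<eta> \<partial>(PP X m t \<gamma>))"
      by (rule continuous_map_eq[OF assms(7)]) (simp add: eq)
    moreover have "(\<lambda>\<gamma>. \<integral>\<eta>. F \<eta> \<partial>(PP X m t \<gamma>)) ` Conf X = F ` Conf X"
      using eq by (intro image_cong) auto
    ultimately show ?thesis using assms(8) by simp
  next
    case False
    obtain b where "lc_base X b" using lc_base_exists[OF assms(1-3)] by blast
    then interpret lc_base X b .
    obtain C where C: "\<And>\<eta>. \<eta> \<in> Conf X \<Longrightarrow> \<bar>F \<eta>\<bar> \<le> C"
      using assms(8) unfolding bounded_iff by auto
    have m: "sets m = sets (borel_of X)" and fin: "\<And>k. emeasure m (K k) < \<infinity>"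
      using assms(4) compact_K unfolding radon_measure_def by auto
    have na: "emeasure m {x} = 0" if "x \<in> topspace X" for x
      using assms(5) that by (simp add: non_atomic_def)
    have p: "is_poisson X m (1 - exp (- t)) (poisson_measure X m (1 - exp (- t)))"
      by (rule is_poisson_poisson_measure[OF m na fin]) (use assms(6) in auto)
    \<comment> \<open>Each kernel has total mass 1 on the Borel sets of the vague topology, so the
      bound \<open>C\<close> of \<open>F\<close> passes unchanged to the integrals.\<close>
    have PP: "prob_space (PP X m t \<gamma>)" "sets (PP X m t \<gamma>) = sets (borel_of (vague X))"
      if "\<gamma> \<in> Conf X" for \<gamma>
    proof -
      let ?\<pi> = "poisson_measure X m (1 - exp (- t))"
      let ?B = "PiM \<gamma> (\<lambda>_. measure_pmf (bernoulli_pmf (exp (- t))))"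
      interpret \<pi>: prob_space ?\<pi> using p by (simp add: is_poisson_def)
      interpret B: prob_space ?B by (intro prob_space_PiM prob_space_measure_pmf)
      interpret P: pair_prob_space ?B ?\<pi> ..
      have s\<pi>: "sets ?\<pi> = sets (borel_of (vague X))" using p by (simp add: is_poisson_def)
      have "(\<lambda>(a, \<eta>). {x\<in>\<gamma>. a x} \<union> \<eta>) \<in> measurable (?B \<Otimes>\<^sub>M ?\<pi>) (borel_of (vague X))"
        using measurable_superposition[OF that _ s\<pi>, of "\<lambda>x. x" \<gamma>] by simp
      then show "prob_space (PP X m t \<gamma>)"
        using False by (simp add: PP_def P.P.prob_space_distr) 
      show "sets (PP X m t \<gamma>) = sets (borel_of (vague X))" using False by (simp add: PP_def)
    qed
    have "continuous_map (vague X) euclideanreal (\<lambda>\<gamma>. \<integral>\<eta>. F \<eta> \<partial>(PP X m t \<gamma>))"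
      by (rule continuous_map_integral_PP[OF assms(7) C False p m na])
    moreover have "bounded ((\<lambda>\<gamma>. \<integral>\<eta>. F \<eta> \<partial>(PP X m t \<gamma>)) ` Conf X)"
      unfolding bounded_iff using abs_integral_vague_le[OF Fm C PP] by (intro exI[of _ C]) auto
    ultimately show ?thesis by blast
  qed
qed

end
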